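(* Let $m,n$ be positive integers, $d=m+n$. Assume $c>0$, $\delta<1$, $\ell\in\mathbb{N}$, and for every $1\le i\le \ell$ let $\mathbf{N}_i=(N_{i,1},\dots,N_{i,d})\in\mathbb{N}^d$ and $\mathbf{v}_i=(v_{i,1},\dots,v_{i,d})\in\mathbb{Z}^d$. Then for Lebesgue-almost every $\theta\in\mathrm{M}_{m,n}(\mathbb{R})$ there exist infinitely many $Q\in\mathbb{N}$ for which there is a collection $\{(\mathbf{p}_i,\mathbf{q}_i)\}_{1\le i\le \ell}\subseteq \mathbb{Z}^m\times\mathbb{Z}^n$ satisfying: (1) $\|\mathbf{q}_i\|\le Q$ for every $1\le i\le\ell$; (2) $\|\theta\mathbf{q}_1+\mathbf{p}_1\|^m\le cQ^{-n}$; (3) $\|\theta\mathbf{q}_i+\mathbf{p}_i\|^m\le cQ^{-\delta n}$ for every $2\le i\le \ell$; (4) $p_{i,j}\equiv v_{i,j}\pmod{N_{i,j}}$ and $q_{i,r}\equiv v_{i,m+r}\pmod{N_{i,m+r}}$ for all $1\le i\le \ell$, $1\le j\le m$, $1\le r\le n$.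
   Context: $\mathrm{M}_{m,n}(\mathbb{R})$ denotes the space of real $m\times n$ matrices. $\|\cdot\|$ denotes the maximum norm on $\mathbb{R}^k$. The coordinates of $\mathbf{p}_i\in\mathbb{Z}^m$ are $p_{i,1},\dots,p_{i,m}$ and those of $\mathbf{q}_i\in\mathbb{Z}^n$ are $q_{i,1},\dots,q_{i,n}$. *)

theory Defs
  imports "HOL-Analysis.Analysis" "HOL-Number_Theory.Cong"
begin

definition maxnorm :: "'a::linordered_idom ^ 'k::finite \<Rightarrow> 'a" where
  "maxnorm x = Max (range (\<lambda>j. \<bar>x $ j\<bar>))"

definition rvec :: "int ^ 'k::finite \<Rightarrow> real ^ 'k" where
  "rvec x = (\<chi> j. real_of_int (x $ j))"

end

theory Submission
  imports Defs
begin

text \<open>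
  For \<open>T\<close> a natural number, rescale the integer point \<open>(p, q)\<close> to
  \<open>(T\<^sup>n (\<theta> q + p), q / T\<^sup>m)\<close>; this gives a unimodular lattice in dimension \<open>m + n\<close>.
  A first-moment estimate bounds the measure of those \<open>\<theta>\<close> whose lattice has a nonzero point of size
  at most \<open>1/h\<close> by \<open>O(1/h)\<close>, uniformly in \<open>T\<close>. Hence for almost every \<open>\<theta>\<close> there is an \<open>h\<close> such
  that no such point exists for infinitely many \<open>T\<close>. By the pigeonhole principle, for such \<open>T\<close> the
  lattice vectors of size at most \<open>R\<close> span the whole space, with \<open>R\<close> depending
  only on \<open>h\<close>, so each residue class of lattice points modulo \<open>N\<close> has a point within a bounded distance
  \<open>M\<close> of any prescribed centre. Taking a centre with \<open>q\<close>-coordinates \<open>2 M\<close> gives solutions with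
  \<open>q\<close> of exact order \<open>T\<^sup>m\<close> and \<open>\<theta> q + p = O(T\<^sup>-\<^sup>n)\<close>. These satisfy the conditions for
  \<open>i \<ge> 2\<close>, since \<open>\<delta> < 1\<close>, but for \<open>i = 1\<close> the constant is too large. However, moving \<open>\<theta>\<close> by
  \<open>O(T\<^sup>-\<^sup>m\<^sup>-\<^sup>n)\<close> makes \<open>\<theta> q\<^sub>1 + p\<^sub>1\<close> vanish, so a ball of radius comparable to
  \<open>T\<^sup>-\<^sup>m\<^sup>-\<^sup>n\<close> near \<open>\<theta>\<close> consists of solvable matrices. The set of exceptional \<open>\<theta>\<close> is therefore
  porous at each of its points, and porous sets are negligible by Vitali's covering theorem.
\<close>

section \<open>Porous sets\<close>

text \<open>Vitali's theorem covers almost all of \<open>S\<close> by disjoint closed balls inside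
  \<open>U\<close>. In each ball a hole missing \<open>S\<close> has the proportion
  \<open>\<kappa> ^ DIM('a)\<close> of the volume, so removing the holes loses that proportion of
  the measure.\<close>

lemma porous_cover:
  fixes S U :: "'a::euclidean_space set"
  assumes "open U" "S \<subseteq> U" "U \<in> lmeasurable" "0 < \<kappa>" "\<kappa> < 1"
    and por: "\<And>x e. x \<in> S \<Longrightarrow> 0 < e \<Longrightarrow>
      \<exists>\<rho> y. 0 < \<rho> \<and> \<rho> < e \<and> ball y (\<kappa> * \<rho>) \<subseteq> cball x \<rho> \<and> ball y (\<kappa> * \<rho>) \<inter> S = {}"
  shows "\<exists>T. S \<subseteq> T \<and> T \<in> lmeasurable \<and> measure lebesgue T \<le> (1 - \<kappa> ^ DIM('a)) * measure lebesgue U"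
proof -
  \<comment> \<open>The index carries the centre of the hole along with the ball, so the subfamily
    selected by Vitali's theorem still knows its holes.\<close>
  define K where "K = {(x, \<rho>, y). 0 < \<rho> \<and> cball x \<rho> \<subseteq> U \<and> ball y (\<kappa> * \<rho>) \<subseteq> cball x \<rho> \<and> ball y (\<kappa> * \<rho>) \<inter> S = {}}"
  obtain C where C: "countable C" "C \<subseteq> K"
    "pairwise (\<lambda>i j. disjnt (cball (fst i) (fst (snd i))) (cball (fst j) (fst (snd j)))) C"
    "negligible (S - (\<Union>i\<in>C. cball (fst i) (fst (snd i))))"
  proof (rule Vitali_covering_theorem_cballs[of K "\<lambda>i. fst (snd i)" S fst])
    show "0 < fst (snd i)" if "i \<in> K" for i using that by (auto simp: K_def)
    fix x d assume x: "x \<in> S" and d: "0 < (d::real)"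
    obtain e where e: "e > 0" "cball x e \<subseteq> U"
      using x assms(1,2) open_contains_cball by blast
    obtain \<rho> y where \<rho>: "0 < \<rho>" "\<rho> < min d e" "ball y (\<kappa> * \<rho>) \<subseteq> cball x \<rho>" "ball y (\<kappa> * \<rho>) \<inter> S = {}"
      using por[OF x, of "min d e"] d e by auto
    have "cball x \<rho> \<subseteq> U" using \<rho>(2) e(2) by (meson min_less_iff_conj less_imp_le order_trans subset_cball)
    then have "(x, \<rho>, y) \<in> K" using \<rho> by (auto simp: K_def)
    then show "\<exists>i. i \<in> K \<and> x \<in> cball (fst i) (fst (snd i)) \<and> fst (snd i) < d"
      using \<rho> by (intro exI[of _ "(x, \<rho>, y)"]) auto
  qed (use that in blast)
  define B where "B i = cball (fst i) (fst (snd i))" for i :: "'a \<times> real \<times> 'a"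
  define H where "H i = ball (snd (snd i)) (\<kappa> * fst (snd i))" for i :: "'a \<times> real \<times> 'a"
  have HB: "H i \<subseteq> B i" "B i \<subseteq> U" "H i \<inter> S = {}" "0 < fst (snd i)" if "i \<in> C" for i
    using subsetD[OF C(2) that] by (simp_all add: K_def H_def B_def split_beta)
  have disB: "disjoint_family_on B C"
    using C(3) by (auto simp: disjoint_family_on_def pairwise_def disjnt_def B_def)
  have disH: "disjoint_family_on H C"
    using disB HB(1) by (fastforce simp: disjoint_family_on_def)
  have BH: "B i \<in> sets lborel" "H i \<in> sets lborel" for i by (auto simp: B_def H_def)
  have eq: "emeasure lborel (H i) = ennreal (\<kappa> ^ DIM('a)) * emeasure lborel (B i)" if "i \<in> C" for i
    using HB(4)[OF that] \<open>0 < \<kappa>\<close>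
    by (simp add: B_def H_def emeasure_ball emeasure_cball power_mult_distrib mult_ac flip: ennreal_mult' ennreal_mult'')
  have sets: "\<Union>(B ` C) \<in> sets lborel" "\<Union>(H ` C) \<in> sets lborel"
    using C(1) BH by (auto intro!: sets.countable_UN')
  have "emeasure lborel (\<Union>(H ` C)) = (\<integral>\<^sup>+ i. emeasure lborel (H i) \<partial>count_space C)"
    by (intro emeasure_UN_countable) (use C disH BH in auto)
  also have "\<dots> = (\<integral>\<^sup>+ i. ennreal (\<kappa> ^ DIM('a)) * emeasure lborel (B i) \<partial>count_space C)"
    by (intro nn_integral_cong) (simp add: eq)
  also have "\<dots> = ennreal (\<kappa> ^ DIM('a)) * (\<integral>\<^sup>+ i. emeasure lborel (B i) \<partial>count_space C)"
    by (intro nn_integral_cmult) auto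
  also have "(\<integral>\<^sup>+ i. emeasure lborel (B i) \<partial>count_space C) = emeasure lborel (\<Union>(B ` C))"
    by (intro emeasure_UN_countable[symmetric]) (use C disB BH in auto)
  finally have 1: "emeasure lborel (\<Union>(H ` C)) = ennreal (\<kappa> ^ DIM('a)) * emeasure lborel (\<Union>(B ` C))" .
  have VU: "\<Union>(B ` C) \<subseteq> U" using HB(2) by auto
  have HV: "\<Union>(H ` C) \<subseteq> \<Union>(B ` C)" using HB(1) by blast
  have lmB: "\<Union>(B ` C) \<in> lmeasurable"
    using fmeasurableI2[OF assms(3) VU] sets(1) by auto
  have lmH: "\<Union>(H ` C) \<in> lmeasurable"
    using fmeasurableI2[OF lmB HV] sets(2) by auto
  have 2: "measure lebesgue (\<Union>(H ` C)) = \<kappa> ^ DIM('a) * measure lebesgue (\<Union>(B ` C))"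
    using 1 sets \<open>0 < \<kappa>\<close> by (simp add: measure_def enn2real_mult)
  define T where "T = (\<Union>(B ` C) - \<Union>(H ` C)) \<union> (S - \<Union>(B ` C))"
  have neg: "negligible (S - \<Union>(B ` C))" using C(4) by (simp add: B_def)
  have "S \<subseteq> T" using HB(3) by (auto simp: T_def)
  moreover have lmT: "T \<in> lmeasurable"
    unfolding T_def by (intro fmeasurable.Un fmeasurable.Diff lmB lmH negligible_imp_measurable neg)
  moreover have "measure lebesgue T \<le> (1 - \<kappa> ^ DIM('a)) * measure lebesgue U"
  proof -
    have "measure lebesgue T \<le> measure lebesgue (\<Union>(B ` C) - \<Union>(H ` C)) + measure lebesgue (S - \<Union>(B ` C))"
      unfolding T_def by (intro measure_Un_le) (use lmB lmH neg negligible_imp_measurable in blast)+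
    also have "measure lebesgue (S - \<Union>(B ` C)) = 0" using neg by (rule negligible_imp_measure0)
    also have "measure lebesgue (\<Union>(B ` C) - \<Union>(H ` C)) = (1 - \<kappa> ^ DIM('a)) * measure lebesgue (\<Union>(B ` C))"
      using measurable_measure_Diff[OF lmB _ HV] lmH 2 by (simp add: algebra_simps fmeasurableD)
    also have "\<dots> \<le> (1 - \<kappa> ^ DIM('a)) * measure lebesgue U"
      using measure_mono_fmeasurable[OF VU _ assms(3)] lmB assms(4,5)
      by (intro mult_left_mono) (auto simp: power_le_one)
    finally show ?thesis by simp
  qed
  ultimately show ?thesis by blast
qed

text \<open>The outer measure \<open>I\<close> of a bounded piece of \<open>S\<close> satisfies
  \<open>I \<le> l * I\<close> with \<open>l < 1\<close>: a measurable cover is enlarged slightly to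
  an open one, and the holes are removed from that. The factor \<open>l\<close> is uniform because
  one \<open>\<kappa>\<close> serves every point and every scale.\<close>

lemma negligible_porous:
  fixes S :: "'a::euclidean_space set"
  assumes "0 < \<kappa>" "\<kappa> < 1"
    and por: "\<And>x e. x \<in> S \<Longrightarrow> 0 < e \<Longrightarrow>
      \<exists>\<rho> y. 0 < \<rho> \<and> \<rho> < e \<and> ball y (\<kappa> * \<rho>) \<subseteq> cball x \<rho> \<and> ball y (\<kappa> * \<rho>) \<inter> S = {}"
  shows "negligible S"
  unfolding negligible_on_intervals[of S]
proof (intro allI)
  fix a b
  define R where "R = S \<inter> cbox a b"
  define \<M> where "\<M> = {T. R \<subseteq> T \<and> T \<in> lmeasurable}"
  define I where "I = (INF T\<in>\<M>. measure lebesgue T)"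
  define l where "l = 1 - \<kappa> ^ DIM('a)"
  have l: "0 \<le> l" "l < 1" using assms(1,2) by (auto simp: l_def power_le_one)
  have ne: "cbox a b \<in> \<M>" by (auto simp: \<M>_def R_def)
  have bdd: "bdd_below (measure lebesgue ` \<M>)" by (rule bdd_belowI[of _ 0]) auto
  have I0: "0 \<le> I" unfolding I_def using ne by (intro cINF_greatest) auto
  have step: "I \<le> l * measure lebesgue T" if T: "T \<in> \<M>" for T
  proof (rule field_le_epsilon)
    fix e :: real assume e: "0 < e"
    have "T \<in> sets lebesgue" using T by (auto simp: \<M>_def)
    from sets_lebesgue_outer_open[OF this e]
    obtain U where U: "open U" "T \<subseteq> U" "U - T \<in> lmeasurable" "emeasure lebesgue (U - T) < ennreal e" by metis
    have Um: "U \<in> lmeasurable"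
      using fmeasurable.Un[of T lebesgue "U - T"] U T by (simp add: \<M>_def Un_absorb1)
    have "measure lebesgue U \<le> measure lebesgue T + measure lebesgue (U - T)"
      using measure_Un_le[of T lebesgue "U - T"] U T by (simp add: \<M>_def Un_absorb1 fmeasurableD)
    also have "measure lebesgue (U - T) \<le> e"
      using U(3,4) e by (simp add: emeasure_eq_measure2 ennreal_less_iff)
    finally have mU: "measure lebesgue U \<le> measure lebesgue T + e" by simp
    have "\<exists>T'. R \<subseteq> T' \<and> T' \<in> lmeasurable \<and> measure lebesgue T' \<le> (1 - \<kappa> ^ DIM('a)) * measure lebesgue U"
    proof (rule porous_cover[OF U(1) _ Um assms(1,2)])
      show "R \<subseteq> U" using T U by (auto simp: \<M>_def)
      fix x e assume "x \<in> R" "0 < (e::real)"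
      then show "\<exists>\<rho> y. 0 < \<rho> \<and> \<rho> < e \<and> ball y (\<kappa> * \<rho>) \<subseteq> cball x \<rho> \<and> ball y (\<kappa> * \<rho>) \<inter> R = {}"
        using por[of x e] unfolding R_def by blast
    qed
    then obtain T' where T': "T' \<in> \<M>" "measure lebesgue T' \<le> l * measure lebesgue U"
      by (auto simp: \<M>_def l_def)
    have "I \<le> measure lebesgue T'" unfolding I_def using bdd T'(1) by (rule cINF_lower)
    also have "\<dots> \<le> l * (measure lebesgue T + e)" using T'(2) mU l by (meson mult_left_mono order_trans)
    also have "\<dots> \<le> l * measure lebesgue T + e" using l e by (simp add: algebra_simps)
    finally show "I \<le> l * measure lebesgue T + e" .
  qed
  have "I = 0"
  proof (cases "l = 0")
    case True
    then show ?thesis using step[OF ne] I0 by simp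
  next
    case False
    \<comment> \<open>By \<open>step\<close>, \<open>I / l\<close> is a lower bound for the measures
      of all covers, hence at most their infimum.\<close>
    have "I / l \<le> I" unfolding I_def using ne
      by (intro cINF_greatest) (use step l False in \<open>auto simp: I_def field_simps\<close>)
    then have "I \<le> l * I" using l False by (simp add: field_simps)
    then have "I * (1 - l) \<le> 0" by (simp add: algebra_simps)
    then show ?thesis using l I0 by (simp add: mult_le_0_iff)
  qed
  show "negligible (S \<inter> cbox a b)"
    unfolding negligible_outer R_def[symmetric]
  proof (intro allI impI)
    fix e :: real assume "e > 0"
    then have "I < e" using \<open>I = 0\<close> by simp
    then show "\<exists>T. R \<subseteq> T \<and> T \<in> lmeasurable \<and> measure lebesgue T < e"
      unfolding I_def using cINF_less_iff[OF _ bdd] ne by (auto simp: \<M>_def)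
  qed
qed

section \<open>Measure of the matrices with a short lattice vector\<close>

lemma card_vec_box:
  "card {x :: 'a ^ 'k::finite. \<forall>k. x $ k \<in> A k} = (\<Prod>k\<in>UNIV. card (A k))"
proof -
  have "bij_betw vec_lambda (\<Pi>\<^sub>E k\<in>UNIV. A k) {x :: 'a ^ 'k. \<forall>k. x $ k \<in> A k}"
    by (rule bij_betwI[where g = vec_nth]) (auto simp: PiE_UNIV_domain)
  then show ?thesis
    by (simp add: card_PiE flip: bij_betw_same_card)
qed

lemma finite_vec_box:
  assumes "\<And>k. finite (A k)"
  shows "finite {x :: 'a ^ 'k::finite. \<forall>k. x $ k \<in> A k}"
proof -
  have "bij_betw vec_lambda (\<Pi>\<^sub>E k\<in>UNIV. A k) {x :: 'a ^ 'k. \<forall>k. x $ k \<in> A k}"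
    by (rule bij_betwI[where g = vec_nth]) (auto simp: PiE_UNIV_domain)
  moreover have "finite (\<Pi>\<^sub>E k\<in>UNIV. A k)" using assms by (intro finite_PiE) auto
  ultimately show ?thesis using bij_betw_finite by blast
qed

text \<open>The measure estimates need a set of finite measure; the space of matrices is later
  exhausted by countably many of these cubes.\<close>

definition mbox :: "real \<Rightarrow> (real ^ 'n::finite ^ 'm::finite) set" where
  "mbox K = cbox (\<chi> j r. - K) (\<chi> j r. K)"

lemma mem_mbox: "\<theta> \<in> mbox K \<longleftrightarrow> (\<forall>j r. \<bar>\<theta> $ j $ r\<bar> \<le> K)"
proof -
  have "\<theta> \<in> mbox K \<longleftrightarrow> (\<forall>j r. - K \<le> \<theta> $ j $ r \<and> \<theta> $ j $ r \<le> K)"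
    unfolding mbox_def mem_box by (auto simp: Basis_vec_def inner_axis axis_eq_axis)
  then show ?thesis by (auto simp: abs_le_iff minus_le_iff)
qed

definition near_integer :: "int ^ 'n::finite \<Rightarrow> real \<Rightarrow> (real ^ 'n ^ 'm::finite) set" where
  "near_integer q r = {\<theta>. \<exists>p. \<forall>j. \<bar>(\<theta> *v rvec q + rvec p) $ j\<bar> \<le> r}"

lemma near_integer_borel:
  fixes q :: "int ^ 'n::finite"
  shows "(near_integer q r :: (real ^ 'n ^ 'm::finite) set) \<in> sets borel"
proof -
  define A where "A p = {\<theta> :: real ^ 'n ^ 'm. \<forall>j. \<bar>(\<theta> *v rvec q + rvec p) $ j\<bar> \<le> r}" for p
  have "closed (A p)" for p
    unfolding A_def
    by (intro closed_Collect_all closed_Collect_le continuous_intros)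
       (auto simp: matrix_vector_mult_def intro!: continuous_intros)
  then have "(\<Union>p. A p) \<in> sets borel"
    by (intro sets.countable_UN' ballI borel_closed) auto
  moreover have "near_integer q r = (\<Union>p. A p)"
    by (auto simp: near_integer_def A_def)
  ultimately show ?thesis by (simp only:)
qed

lemma near_integer_lmeasurable:
  "(near_integer q r \<inter> mbox K :: (real ^ 'n::finite ^ 'm::finite) set) \<in> lmeasurable"
proof -
  have "(near_integer q r :: (real ^ 'n ^ 'm) set) \<in> sets lebesgue"
    using near_integer_borel by (metis sets_completionI_sets sets_lborel)
  then have "(mbox K \<inter> near_integer q r :: (real ^ 'n ^ 'm) set) \<in> lmeasurable"
    by (intro fmeasurable_Int_fmeasurable) (auto simp: mbox_def)
  then show ?thesis by (simp add: Int_commute)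
qed

lemma near_integer_measure:
  fixes q :: "int ^ 'n::finite"
  assumes "q \<noteq> 0" "0 < r" "r \<le> 1 / 6"
  shows "measure lebesgue (near_integer q r \<inter> mbox K :: (real ^ 'n ^ 'm::finite) set)
     \<le> (6 * r) ^ CARD('m) * measure lebesgue (mbox (K + 1) :: (real ^ 'n ^ 'm) set)"
proof -
  txt \<open>Changing column \<open>s\<close> of \<open>\<theta>\<close> so that \<open>\<theta> q\<close> moves by \<open>u / M\<close> with \<open>0 \<le> u < M\<close> gives
    \<open>M\<^sup>m\<close> pairwise disjoint translates of the set, where \<open>2 r < 1 / M\<close>.\<close>
  obtain s where s: "q $ s \<noteq> 0" using assms(1) by (auto simp: vec_eq_iff)
  \<comment> \<open>Rounding down gives \<open>2 * r * M < 1\<close>, which keeps the translates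
    apart, while \<open>6 * r * M \<ge> 1\<close> costs only a constant in the bound.\<close>
  define M where "M = nat \<lfloor>1 / (3 * r)\<rfloor>"
  have r2: "2 \<le> 1 / (3 * r)" using assms(2,3) by (simp add: field_simps)
  have M: "real M \<le> 1 / (3 * r)" "1 / (3 * r) < real M + 1" using r2 by (simp_all add: M_def of_nat_nat) linarith+
  have M1: "M \<ge> 1" using M(2) r2 by linarith
  have "1 / (3 * r) \<le> 2 * real M" using M(2) M1 by linarith
  then have Mr: "1 \<le> 6 * r * real M" using assms(2) by (simp add: field_simps)
  have rM: "2 * r * real M < 1" using M(1) assms(2) by (simp add: field_simps)
  let ?A = "near_integer q r \<inter> mbox K :: (real ^ 'n ^ 'm) set"
  define J where "J = {u :: int ^ 'm. \<forall>j. u $ j \<in> {0..<int M}}"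
  have finJ: "finite J" unfolding J_def by (rule finite_vec_box) auto
  have cardJ: "card J = M ^ CARD('m)" unfolding J_def by (subst card_vec_box) simp
  define t :: "int ^ 'm \<Rightarrow> real ^ 'n ^ 'm"
    where "t u = (\<chi> j i. if i = s then of_int (u $ j) / (real M * of_int (q $ s)) else 0)" for u
  have tq: "(t u *v rvec q) $ j = of_int (u $ j) / real M" for u j
  proof -
    have "(t u *v rvec q) $ j = (\<Sum>i\<in>UNIV. if i = s then of_int (u $ j) / real M else 0)"
      unfolding matrix_vector_mult_def t_def rvec_def vec_lambda_beta using s by (intro sum.cong) auto
    then show ?thesis by simp
  qed
  \<comment> \<open>Since \<open>\<bar>q $ s\<bar> \<ge> 1\<close>, a translation moves every entry
    by at most 1, which is why the translates fit into \<open>mbox (K + 1)\<close>.\<close>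
  have tb: "\<bar>t u $ j $ i\<bar> \<le> 1" if "u \<in> J" for u j i
  proof -
    have "0 \<le> u $ j" "u $ j < int M" using that by (auto simp: J_def)
    moreover have "1 \<le> \<bar>q $ s\<bar>" using s by linarith
    ultimately have "\<bar>u $ j\<bar> * 1 \<le> int M * \<bar>q $ s\<bar>" by (intro mult_mono) auto
    then have "real_of_int (\<bar>u $ j\<bar> * 1) \<le> real_of_int (int M * \<bar>q $ s\<bar>)" by (subst of_int_le_iff)
    then have "\<bar>real_of_int (u $ j)\<bar> \<le> real M * \<bar>real_of_int (q $ s)\<bar>" by simp
    then show ?thesis using s M1 by (simp add: t_def abs_mult divide_le_eq)
  qed
  have dis: "disjnt ((+) (t u) ` ?A) ((+) (t v) ` ?A)" if "u \<in> J" "v \<in> J" "u \<noteq> v" for u v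
  proof (rule ccontr)
    assume "\<not> ?thesis"
    then obtain x y where xy: "x \<in> near_integer q r" "y \<in> near_integer q r" "t u + x = t v + y"
      by (auto simp: disjnt_def)
    then obtain a b where ab: "\<And>j. \<bar>(x *v rvec q + rvec a) $ j\<bar> \<le> r" "\<And>j. \<bar>(y *v rvec q + rvec b) $ j\<bar> \<le> r"
      by (auto simp: near_integer_def)
    have "u $ j = v $ j" for j
    proof -
      have "(t u *v rvec q + x *v rvec q) $ j = (t v *v rvec q + y *v rvec q) $ j"
        using xy(3) by (metis matrix_vector_mult_add_rdistrib)
      then have "of_int (u $ j) / real M + (x *v rvec q) $ j = of_int (v $ j) / real M + (y *v rvec q) $ j"
        by (simp add: tq)
      moreover have "\<bar>(x *v rvec q) $ j + of_int (a $ j)\<bar> \<le> r" "\<bar>(y *v rvec q) $ j + of_int (b $ j)\<bar> \<le> r"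
        using ab[of j] by (auto simp: rvec_def)
      ultimately have "\<bar>of_int (u $ j) / real M - of_int (v $ j) / real M + of_int (b $ j - a $ j)\<bar> \<le> 2 * r"
        by simp
      then have "real M * \<bar>of_int (u $ j) / real M - of_int (v $ j) / real M + of_int (b $ j - a $ j)\<bar> \<le> real M * (2 * r)"
        using M1 by (intro mult_left_mono) auto
      also have "real M * \<bar>of_int (u $ j) / real M - of_int (v $ j) / real M + of_int (b $ j - a $ j)\<bar>
         = \<bar>real M * (of_int (u $ j) / real M - of_int (v $ j) / real M + of_int (b $ j - a $ j))\<bar>"
        by (simp add: abs_mult)
      also have "real M * (of_int (u $ j) / real M - of_int (v $ j) / real M + of_int (b $ j - a $ j))
         = of_int (u $ j - v $ j + int M * (b $ j - a $ j))"
        using M1 by (simp add: algebra_simps)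
      \<comment> \<open>An integer of absolute value below 1 vanishes, so \<open>u $ j\<close> and
        \<open>v $ j\<close> agree modulo \<open>M\<close>, and both are reduced residues.\<close>
      finally have "\<bar>real_of_int (u $ j - v $ j + int M * (b $ j - a $ j))\<bar> < 1" using rM by (simp add: mult_ac)
      then have "u $ j - v $ j + int M * (b $ j - a $ j) = 0" by linarith
      then have "u $ j = v $ j + int M * (a $ j - b $ j)" by (simp add: algebra_simps)
      then have "u $ j mod int M = v $ j mod int M" by simp
      then show ?thesis using that(1,2) by (simp add: J_def)
    qed
    then show False using that(3) by (simp add: vec_eq_iff)
  qed
  have inj: "pairwise (\<lambda>u v. disjnt ((+) (t u) ` ?A) ((+) (t v) ` ?A)) J"
    using dis by (auto simp: pairwise_def)
  have "real M ^ CARD('m) * measure lebesgue ?A = (\<Sum>u\<in>J. measure lebesgue ((+) (t u) ` ?A))"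
    by (simp add: measure_translation cardJ)
  also have "\<dots> = measure lebesgue (\<Union>u\<in>J. (+) (t u) ` ?A)"
    by (rule measure_UNION'[symmetric, OF finJ _ inj]) (simp add: measurable_translation near_integer_lmeasurable)
  also have "\<dots> \<le> measure lebesgue (mbox (K + 1) :: (real ^ 'n ^ 'm) set)"
  proof (rule measure_mono_fmeasurable)
    show "(\<Union>u\<in>J. (+) (t u) ` ?A) \<subseteq> mbox (K + 1)"
    proof (clarsimp simp: mem_mbox)
      fix u and x :: "real ^ 'n ^ 'm" and j i
      assume "u \<in> J" "\<forall>j i. \<bar>x $ j $ i\<bar> \<le> K"
      then have "\<bar>x $ j $ i\<bar> \<le> K" "\<bar>t u $ j $ i\<bar> \<le> 1" using tb by auto
      then show "\<bar>t u $ j $ i + x $ j $ i\<bar> \<le> K + 1" by linarith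
    qed
    show "(\<Union>u\<in>J. (+) (t u) ` ?A) \<in> sets lebesgue"
      using finJ by (intro sets.finite_UN fmeasurableD measurable_translation near_integer_lmeasurable)
  qed (simp add: mbox_def)
  finally have *: "real M ^ CARD('m) * measure lebesgue ?A \<le> measure lebesgue (mbox (K + 1) :: (real ^ 'n ^ 'm) set)" .
  have "1 * measure lebesgue ?A \<le> (6 * r * real M) ^ CARD('m) * measure lebesgue ?A"
    using Mr by (intro mult_right_mono one_le_power) auto
  also have "\<dots> = (6 * r) ^ CARD('m) * (real M ^ CARD('m) * measure lebesgue ?A)"
    by (simp add: power_mult_distrib mult_ac)
  also have "\<dots> \<le> (6 * r) ^ CARD('m) * measure lebesgue (mbox (K + 1) :: (real ^ 'n ^ 'm) set)"
    using * assms(2) by (intro mult_left_mono) auto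
  finally show ?thesis by simp
qed

text \<open>The inequalities place the rescaled point in the cube of half-side \<open>1 / h\<close>.
  The conclusion \<open>q = 0\<close> suffices: for \<open>h \<ge> 2\<close> and
  \<open>T \<ge> 1\<close> it forces \<open>p = 0\<close> as well.\<close>

definition has_gap :: "nat \<Rightarrow> nat \<Rightarrow> real ^ 'n::finite ^ 'm::finite \<Rightarrow> bool" where
  "has_gap T h \<theta> \<longleftrightarrow> (\<forall>p q. (\<forall>j. \<bar>(\<theta> *v rvec q + rvec p) $ j\<bar> \<le> 1 / (real h * real T ^ CARD('n))) \<longrightarrow>
     (\<forall>r. real h * \<bar>real_of_int (q $ r)\<bar> \<le> real T ^ CARD('m)) \<longrightarrow> q = 0)"

text \<open>A union bound over the at most \<open>(3 T\<^sup>m / h)\<^sup>n\<close> nonzero vectors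
  \<open>q\<close>, each contributing at most \<open>(6 / (h T\<^sup>n))\<^sup>m\<close> times the
  volume of the larger cube. The powers of \<open>T\<close> cancel, and of the remaining factor
  \<open>h\<close> to the power \<open>- (m + n)\<close> only \<open>1 / h\<close> is kept.\<close>

lemma no_gap_measure:
  fixes K :: real
  assumes "T \<ge> 1" "h \<ge> 6"
  defines "X \<equiv> {\<theta> \<in> mbox K. \<not> has_gap T h \<theta>} :: (real ^ 'n::finite ^ 'm::finite) set"
  shows "X \<in> lmeasurable"
    and "measure lebesgue X \<le> 3 ^ CARD('n) * 6 ^ CARD('m) * measure lebesgue (mbox (K + 1) :: (real ^ 'n ^ 'm) set) / h"
proof -
  define r where "r = 1 / (real h * real T ^ CARD('n))"
  define B where "B = T ^ CARD('m) div h"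
  define V where "V = measure lebesgue (mbox (K + 1) :: (real ^ 'n ^ 'm) set)"
  define F :: "(int ^ 'n) set" where "F = {q. \<forall>k. q $ k \<in> {- int B..int B}} - {0}"
  have finF: "finite F" unfolding F_def by (intro finite_Diff finite_vec_box) auto
  have Fiff: "real h * \<bar>real_of_int z\<bar> \<le> real T ^ CARD('m) \<longleftrightarrow> z \<in> {- int B..int B}" for z
  proof -
    have "real h * \<bar>real_of_int z\<bar> \<le> real T ^ CARD('m) \<longleftrightarrow> real (h * nat \<bar>z\<bar>) \<le> real (T ^ CARD('m))" by simp
    also have "\<dots> \<longleftrightarrow> nat \<bar>z\<bar> \<le> B"
      using assms(2) unfolding of_nat_le_iff B_def by (subst less_eq_div_iff_mult_less_eq) (auto simp: mult.commute)
    finally show ?thesis by auto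
  qed
  have X: "X = (\<Union>q\<in>F. near_integer q r \<inter> mbox K)"
    unfolding X_def F_def has_gap_def near_integer_def Fiff r_def by blast
  show "X \<in> lmeasurable"
    unfolding X using finF by (intro fmeasurable.finite_UN near_integer_lmeasurable)
  have r: "0 < r" "r \<le> 1 / 6"
  proof -
    have "1 \<le> real T ^ CARD('n)" using assms(1) by simp
    then have "6 * 1 \<le> real h * real T ^ CARD('n)" using assms(2) by (intro mult_mono) auto
    then show "0 < r" "r \<le> 1 / 6" by (auto simp: r_def field_simps)
  qed
  have V0: "0 \<le> V" by (simp add: V_def)
  \<comment> \<open>For \<open>B \<ge> 1\<close> the count \<open>2 * B + 1\<close> is at most
    \<open>3 * B\<close>. For \<open>B = 0\<close> only \<open>q = 0\<close> meets the bounds, and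
    it is excluded from \<open>F\<close>.\<close>
  have cF: "real (card F) \<le> (3 * (real T ^ CARD('m) / real h)) ^ CARD('n)"
  proof (cases "B = 0")
    case True
    then have "F = {}" by (auto simp: F_def vec_eq_iff)
    then show ?thesis by simp
  next
    case False
    have "card F \<le> card {q :: int ^ 'n. \<forall>k. q $ k \<in> {- int B..int B}}"
      unfolding F_def by (intro card_mono finite_vec_box) auto
    also have "\<dots> = (2 * B + 1) ^ CARD('n)" by (subst card_vec_box) (simp add: nat_add_distrib nat_mult_distrib)
    also have "\<dots> \<le> (3 * B) ^ CARD('n)" using False by (intro power_mono) auto
    finally have "real (card F) \<le> (3 * real B) ^ CARD('n)" by (metis of_nat_le_iff of_nat_mult of_nat_numeral of_nat_power)
    also have "\<dots> \<le> (3 * (real T ^ CARD('m) / real h)) ^ CARD('n)"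
      unfolding B_def by (intro power_mono mult_left_mono) (auto intro: order_trans[OF of_nat_div_le_of_nat])
    finally show ?thesis .
  qed
  have "measure lebesgue X \<le> (\<Sum>q\<in>F. measure lebesgue (near_integer q r \<inter> mbox K :: (real ^ 'n ^ 'm) set))"
    unfolding X using finF by (intro measure_UNION_le fmeasurableD near_integer_lmeasurable)
  also have "\<dots> \<le> (\<Sum>q\<in>F. (6 * r) ^ CARD('m) * V)"
    unfolding V_def using r by (intro sum_mono near_integer_measure) (auto simp: F_def)
  also have "\<dots> = real (card F) * ((6 * r) ^ CARD('m) * V)" by simp
  also have "\<dots> \<le> (3 * (real T ^ CARD('m) / real h)) ^ CARD('n) * ((6 * r) ^ CARD('m) * V)"
    using cF r V0 by (intro mult_right_mono) auto
  also have "\<dots> = 3 ^ CARD('n) * 6 ^ CARD('m) * V / real h ^ (CARD('n) + CARD('m))"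
    using assms(1) by (simp add: r_def field_simps power_mult_distrib power_add flip: power_mult)
  also have "\<dots> \<le> 3 ^ CARD('n) * 6 ^ CARD('m) * V / real h"
  proof (rule divide_left_mono)
    show "real h \<le> real h ^ (CARD('n) + CARD('m))"
      using assms(2) by (intro self_le_power) (auto simp: add_pos_pos)
  qed (use V0 assms(2) in auto)
  finally show "measure lebesgue X \<le> 3 ^ CARD('n) * 6 ^ CARD('m) * V / h" .
qed

text \<open>On a bounded cube and for fixed \<open>h\<close>, the matrices without a gap at any
  \<open>T\<close> beyond \<open>T0\<close> lie in a set of measure at most \<open>C / h\<close>,
  uniformly in \<open>T0\<close>. These sets increase with \<open>T0\<close>, so their union obeys
  the same bound, which is small for large \<open>h\<close>.\<close>

lemma negligible_eventually_no_gap: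
  "negligible {\<theta> :: real ^ 'n::finite ^ 'm::finite. \<forall>h\<ge>6. \<exists>T0. \<forall>T\<ge>T0. \<not> has_gap T h \<theta>}" (is "negligible ?S")
proof -
  have "negligible (?S \<inter> mbox (real K))" for K :: nat
    unfolding negligible_outer_le
  proof (intro allI impI)
    fix e :: real assume e: "0 < e"
    define C where "C = 3 ^ CARD('n) * 6 ^ CARD('m) * measure lebesgue (mbox (real K + 1) :: (real ^ 'n ^ 'm) set)"
    obtain h0 :: nat where h0: "C / e < real h0" using reals_Archimedean2 by blast
    define h where "h = max h0 6"
    have h: "h \<ge> 6" by (simp add: h_def)
    have "C / e \<le> real h" using h0 by (simp add: h_def)
    then have Ch: "C / h \<le> e" using e h by (simp add: field_simps)
    define X where "X T = ({\<theta> \<in> mbox (real K). \<not> has_gap T h \<theta>} :: (real ^ 'n ^ 'm) set)" for T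
    have X: "X T \<in> lmeasurable" "measure lebesgue (X T) \<le> e" if "T \<ge> 1" for T
      using no_gap_measure[OF that h, of "real K", where 'n='n and 'm='m] Ch by (auto simp: X_def C_def)
    \<comment> \<open>Starting at \<open>Suc T0\<close> keeps \<open>T \<ge> 1\<close>, as the
      measure estimate requires.\<close>
    define D where "D T0 = (\<Inter>T\<in>{Suc T0..}. X T)" for T0
    have Ds: "D T0 \<in> sets lebesgue" for T0
      unfolding D_def by (intro sets.countable_INT') (use X in auto)
    have De: "emeasure lebesgue (D T0) \<le> ennreal e" for T0
    proof -
      have "emeasure lebesgue (D T0) \<le> emeasure lebesgue (X (Suc T0))"
        using X[of "Suc T0"] by (intro emeasure_mono) (auto simp: D_def)
      also have "\<dots> \<le> ennreal e" using X[of "Suc T0"] by (simp add: emeasure_eq_measure2 ennreal_leI)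
      finally show ?thesis .
    qed
    have "emeasure lebesgue (\<Union>T0. D T0) = (SUP T0. emeasure lebesgue (D T0))"
      by (intro SUP_emeasure_incseq[symmetric]) (use Ds in \<open>auto simp: incseq_def D_def\<close>)
    also have "\<dots> \<le> ennreal e" using De by (intro SUP_least)
    finally have 1: "emeasure lebesgue (\<Union>T0. D T0) \<le> ennreal e" .
    have 2: "(\<Union>T0. D T0) \<in> lmeasurable"
      using Ds le_less_trans[OF 1] by (intro fmeasurableI) auto
    have 3: "?S \<inter> mbox (real K) \<subseteq> (\<Union>T0. D T0)"
    proof
      fix \<theta> assume "\<theta> \<in> ?S \<inter> mbox (real K)"
      then obtain T0 where "\<forall>T\<ge>T0. \<not> has_gap T h \<theta>" "\<theta> \<in> mbox (real K)" using h by blast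
      then have "\<theta> \<in> D T0" by (auto simp: D_def X_def)
      then show "\<theta> \<in> (\<Union>T0. D T0)" by blast
    qed
    have "measure lebesgue (\<Union>T0. D T0) \<le> e"
      using 1 2 e by (simp add: emeasure_eq_measure2)
    with 2 3 show "\<exists>T. ?S \<inter> mbox (real K) \<subseteq> T \<and> T \<in> lmeasurable \<and> measure lebesgue T \<le> e" by blast
  qed
  then have "negligible (\<Union>K::nat. ?S \<inter> mbox (real K))" by (rule negligible_Union_nat)
  moreover have "?S \<subseteq> (\<Union>K::nat. ?S \<inter> mbox (real K))"
  proof
    fix \<theta> assume "\<theta> \<in> ?S"
    obtain K :: nat where K: "norm \<theta> < real K" using reals_Archimedean2 by blast
    have "\<bar>\<theta> $ j $ r\<bar> \<le> real K" for j r
      using component_le_norm_cart[of "\<theta> $ j" r] Finite_Cartesian_Product.norm_nth_le[of \<theta> j] K by linarith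
    then show "\<theta> \<in> (\<Union>K::nat. ?S \<inter> mbox (real K))" using \<open>\<theta> \<in> ?S\<close> by (auto simp: mem_mbox)
  qed
  ultimately show ?thesis using negligible_subset by blast
qed

section \<open>Lattices without short vectors\<close>

text \<open>If the lattice vectors of size at most \<open>R\<close> were all orthogonal to
  \<open>a\<close>, the pair found here would differ by a nonzero vector below the gap. The lower
  bound on \<open>R\<close> makes the cells fewer than the points.\<close>

lemma pigeonhole_cells:
  fixes Y :: "(real ^ 'k::finite) set" and a :: "real ^ 'k" and L :: "'k \<Rightarrow> nat"
  assumes "a \<noteq> 0" "h \<ge> 1" and R: "2 * (h * CARD('k)) ^ CARD('k) < R" and L: "\<And>k. R \<le> L k"
    and Y: "finite Y" "(\<Prod>k\<in>UNIV. L k) \<le> card Y" "\<And>y k. y \<in> Y \<Longrightarrow> 0 \<le> y $ k \<and> y $ k < L k"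
  obtains y y' where "y \<in> Y" "y' \<in> Y" "y \<noteq> y'" "\<And>k. \<bar>(y - y') $ k\<bar> \<le> R"
    "a \<bullet> (y - y') = 0 \<Longrightarrow> (\<And>k. \<bar>(y - y') $ k\<bar> \<le> 1 / h)"
proof -
  obtain i where i: "\<bar>a $ k\<bar> \<le> \<bar>a $ i\<bar>" for k
  proof -
    have "Max (range (\<lambda>k. \<bar>a $ k\<bar>)) \<in> range (\<lambda>k. \<bar>a $ k\<bar>)" by (intro Max_in) auto
    then obtain i where "Max (range (\<lambda>k. \<bar>a $ k\<bar>)) = \<bar>a $ i\<bar>" by (rule imageE)
    then have "\<bar>a $ k\<bar> \<le> \<bar>a $ i\<bar>" for k by (metis Max_ge finite finite_imageI rangeI)
    then show thesis by (rule that)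
  qed
  have ai: "a $ i \<noteq> 0" using assms(1) i by (metis abs_le_zero_iff abs_zero vec_eq_iff zero_index)
  txt \<open>Cells have side \<open>1 / g\<close> in every coordinate but \<open>i\<close>, where they have side \<open>R\<close>. In coordinate \<open>i\<close>
    the coefficient of \<open>a\<close> is largest, so for a difference orthogonal to \<open>a\<close> this coordinate is
    controlled by the others.\<close>
  define D where "D = CARD('k)"
  define g where "g = h * D"
  have D: "D \<ge> 1" by (simp add: D_def Suc_leI)
  have g: "g \<ge> h" "g \<ge> 1" using D assms(2) by (auto simp: g_def)
  have Rpos: "R > 0" using R by simp
  define key where "key y = (\<chi> k. if k = i then \<lfloor>y $ k / R\<rfloor> else \<lfloor>g * y $ k\<rfloor>)" for y :: "real ^ 'k"
  define A where "A k = (if k = i then {0..int (L k div R)} else {0..<int (g * L k)})" for k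
  have keyA: "key y \<in> {x. \<forall>k. x $ k \<in> A k}" if "y \<in> Y" for y
  proof -
    have y: "0 \<le> y $ k" "y $ k < L k" for k using Y(3)[OF that] by auto
    have "\<lfloor>y $ i / R\<rfloor> \<le> \<lfloor>real (L i) / real R\<rfloor>" using y(2)[of i] Rpos by (intro floor_mono divide_right_mono) auto
    also have "\<dots> = int (L i div R)" by (rule floor_divide_of_nat_eq)
    finally have "\<lfloor>y $ i / R\<rfloor> \<in> A i" using y(1) by (simp add: A_def)
    moreover have "\<lfloor>g * y $ k\<rfloor> \<in> A k" if "k \<noteq> i" for k
      using y[of k] that g(2) by (simp add: A_def floor_less_iff)
    ultimately show ?thesis by (auto simp: key_def)
  qed
  \<comment> \<open>Multiplying the number of cells by \<open>R\<close> avoids a division: the long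
    coordinate gives \<open>R * (L i div R + 1) \<le> 2 * L i\<close>, by
    \<open>R \<le> L i\<close>, and the others give the factor \<open>g ^ (D - 1)\<close>.\<close>
  have "R * (\<Prod>k\<in>UNIV. card (A k)) = R * (L i div R + 1) * (\<Prod>k\<in>UNIV - {i}. g * L k)"
    by (subst prod.remove[of _ i]) (simp_all add: A_def nat_add_distrib nat_mult_distrib algebra_simps)
  also have "\<dots> \<le> 2 * L i * (\<Prod>k\<in>UNIV - {i}. g * L k)"
  proof (rule mult_right_mono)
    have "R * (L i div R + 1) = R * (L i div R) + R" by simp
    also have "\<dots> \<le> L i + L i" by (intro add_mono times_div_less_eq_dividend L)
    finally show "R * (L i div R + 1) \<le> 2 * L i" by simp
  qed simp
  also have "2 * L i * (\<Prod>k\<in>UNIV - {i}. g * L k) = 2 * g ^ (D - 1) * (\<Prod>k\<in>UNIV. L k)"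
    by (simp add: prod.distrib prod.remove[of UNIV i L] D_def card_Diff_singleton)
  also have "\<dots> < R * (\<Prod>k\<in>UNIV. L k)"
  proof (rule mult_strict_right_mono)
    have "g ^ (D - 1) \<le> g ^ D" using g by (intro power_increasing) auto
    then show "2 * g ^ (D - 1) < R" using R by (simp add: g_def D_def)
    show "0 < (\<Prod>k\<in>UNIV. L k)" using L Rpos by (intro prod_pos) (metis less_le_trans)
  qed
  finally have "(\<Prod>k\<in>UNIV. card (A k)) < (\<Prod>k\<in>UNIV. L k)" using Rpos by simp
  then have "card {x :: int ^ 'k. \<forall>k. x $ k \<in> A k} < card Y" using Y(2) by (simp add: card_vec_box)
  moreover have "finite {x :: int ^ 'k. \<forall>k. x $ k \<in> A k}" by (rule finite_vec_box) (simp add: A_def)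
  moreover have "key ` Y \<subseteq> {x. \<forall>k. x $ k \<in> A k}" using keyA by blast
  ultimately have "\<not> inj_on key Y" using card_inj_on_le[of key Y] by (meson not_le)
  then obtain y y' where y: "y \<in> Y" "y' \<in> Y" "y \<noteq> y'" "key y = key y'" by (auto simp: inj_on_def)
  have key: "(if k = i then \<lfloor>y $ k / R\<rfloor> else \<lfloor>g * y $ k\<rfloor>) = (if k = i then \<lfloor>y' $ k / R\<rfloor> else \<lfloor>g * y' $ k\<rfloor>)" for k
    using y(4) by (simp add: key_def vec_eq_iff)
  have fl: "\<bar>u - v\<bar> < 1" if "\<lfloor>u\<rfloor> = \<lfloor>v\<rfloor>" for u v :: real using that by linarith
  define z where "z = y - y'"
  have zk: "\<bar>z $ k\<bar> \<le> 1 / g" if "k \<noteq> i" for k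
  proof -
    have "\<bar>g * y $ k - g * y' $ k\<bar> < 1" using key[of k] that fl by simp
    also have "\<bar>g * y $ k - g * y' $ k\<bar> = g * \<bar>z $ k\<bar>" by (simp add: z_def abs_mult flip: right_diff_distrib)
    finally show ?thesis using g by (simp add: field_simps)
  qed
  have zi: "\<bar>z $ i\<bar> \<le> R"
  proof -
    have "\<bar>y $ i / R - y' $ i / R\<bar> < 1" using key[of i] fl by simp
    also have "\<bar>y $ i / R - y' $ i / R\<bar> = \<bar>z $ i\<bar> / R" by (simp add: z_def flip: diff_divide_distrib)
    finally show ?thesis using Rpos by (simp add: field_simps)
  qed
  have gh: "1 / real g \<le> 1 / real h" using g assms(2) by (intro divide_left_mono) auto
  have h1: "1 / real h \<le> 1" "1 \<le> real R" using assms(2) Rpos by auto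
  show thesis
  proof (rule that[of y y'])
    fix k
    show "\<bar>(y - y') $ k\<bar> \<le> R" using zi zk[of k] gh h1 by (cases "k = i") (auto simp: z_def)
    assume "a \<bullet> (y - y') = 0"
    then have "a $ i * z $ i + (\<Sum>k\<in>UNIV - {i}. a $ k * z $ k) = 0"
      by (simp add: inner_vec_def z_def sum.remove[of UNIV i])
    \<comment> \<open>Orthogonality expresses \<open>z $ i\<close> through \<open>D - 1\<close>
      terms, each at most \<open>\<bar>a $ i\<bar> / g\<close>; as \<open>g = h * D\<close>, they
      sum to at most \<open>\<bar>a $ i\<bar> / h\<close>.\<close>
    then have "\<bar>a $ i\<bar> * \<bar>z $ i\<bar> = \<bar>\<Sum>k\<in>UNIV - {i}. a $ k * z $ k\<bar>"
      by (simp flip: abs_mult)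
    also have "\<dots> \<le> (\<Sum>k\<in>UNIV - {i}. \<bar>a $ i\<bar> * (1 / g))"
      using i zk by (intro order_trans[OF sum_abs] sum_mono) (auto simp: abs_mult intro!: mult_mono simp del: times_divide_eq_right)
    also have "\<dots> \<le> (\<Sum>k\<in>(UNIV :: 'k set). \<bar>a $ i\<bar> * (1 / g))"
      by (intro sum_mono2) auto
    also have "\<dots> = \<bar>a $ i\<bar> * (1 / h)" using D by (simp add: g_def D_def)
    finally have "\<bar>z $ i\<bar> \<le> 1 / h" by (rule mult_left_le_imp_le) (simp add: ai)
    moreover have "\<bar>z $ k\<bar> \<le> 1 / h" if "k \<noteq> i" using zk[OF that] gh by linarith
    ultimately show "\<bar>(y - y') $ k\<bar> \<le> 1 / h" unfolding z_def by blast
  qed (use y in auto)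
qed

text \<open>A proper span has a nonzero orthogonal vector \<open>a\<close>. Two points of
  \<open>Y\<close> in one cell differ by a vector of \<open>\<Lambda>\<close> of size at most
  \<open>R\<close>, hence orthogonal to \<open>a\<close>, hence of size at most
  \<open>1 / h\<close>, contrary to the gap. The lower bound on \<open>card Y\<close> stands in for
  a covolume of at most 1.\<close>

lemma span_short_vectors:
  fixes \<Lambda> Y :: "(real ^ 'k::finite) set" and L :: "'k \<Rightarrow> nat"
  assumes diff: "\<And>x y. x \<in> \<Lambda> \<Longrightarrow> y \<in> \<Lambda> \<Longrightarrow> x - y \<in> \<Lambda>"
    and gap: "\<And>x. x \<in> \<Lambda> \<Longrightarrow> (\<And>k. \<bar>x $ k\<bar> \<le> 1 / h) \<Longrightarrow> x = 0"
    and "h \<ge> 1" "2 * (h * CARD('k)) ^ CARD('k) < R" "\<And>k. R \<le> L k"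
    and Y: "finite Y" "(\<Prod>k\<in>UNIV. L k) \<le> card Y" "\<And>y k. y \<in> Y \<Longrightarrow> 0 \<le> y $ k \<and> y $ k < L k" "Y \<subseteq> \<Lambda>"
  shows "span {x \<in> \<Lambda>. \<forall>k. \<bar>x $ k\<bar> \<le> real R} = UNIV"
proof (rule ccontr)
  let ?S = "{x \<in> \<Lambda>. \<forall>k. \<bar>x $ k\<bar> \<le> real R}"
  assume "span ?S \<noteq> UNIV"
  then have "span ?S \<subset> span UNIV" by (simp add: top.not_eq_extremum)
  then obtain a where a: "a \<noteq> 0" "\<And>x. x \<in> span ?S \<Longrightarrow> orthogonal a x"
    using orthogonal_to_subspace_exists_gen[of ?S UNIV] by blast
  show False
  proof (rule pigeonhole_cells[OF a(1) assms(3-5) Y(1-3)])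
    fix y y' assume y: "y \<in> Y" "y' \<in> Y" "y \<noteq> y'" "\<And>k. \<bar>(y - y') $ k\<bar> \<le> real R"
      and imp: "a \<bullet> (y - y') = 0 \<Longrightarrow> (\<And>k. \<bar>(y - y') $ k\<bar> \<le> 1 / real h)"
    have z: "y - y' \<in> \<Lambda>" using y Y(4) diff by blast
    then have "y - y' \<in> span ?S" using y(4) by (intro span_base) auto
    then have "a \<bullet> (y - y') = 0" using a(2) by (simp add: orthogonal_def)
    then have "y - y' = 0" using gap[OF z] imp by blast
    then show False using y(3) by simp
  qed
qed

text \<open>The vector \<open>(z - w) / N\<close> is expanded in a basis of short vectors of
  \<open>\<Lambda>\<close> and its coefficients are rounded down. The error is \<open>N\<close>
  times a combination of \<open>CARD('k)\<close> vectors of size at most \<open>R\<close> with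
  coefficients in \<open>[0, 1)\<close>. Adding \<open>N x\<close> to \<open>w\<close> preserves
  residues modulo \<open>N\<close>.\<close>

lemma round_to_lattice:
  fixes \<Lambda> :: "(real ^ 'k::finite) set" and R :: real
  assumes add: "\<And>x y. x \<in> \<Lambda> \<Longrightarrow> y \<in> \<Lambda> \<Longrightarrow> x + y \<in> \<Lambda>" and zero: "0 \<in> \<Lambda>"
    and scale: "\<And>x (t::int). x \<in> \<Lambda> \<Longrightarrow> of_int t *\<^sub>R x \<in> \<Lambda>"
    and span: "span {x \<in> \<Lambda>. \<forall>k. \<bar>x $ k\<bar> \<le> R} = UNIV" and "N \<ge> (1::nat)"
  obtains x where "x \<in> \<Lambda>" "\<And>k. \<bar>(w + real N *\<^sub>R x) $ k - z $ k\<bar> \<le> N * CARD('k) * R"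
proof -
  obtain B where B: "B \<subseteq> {x \<in> \<Lambda>. \<forall>k. \<bar>x $ k\<bar> \<le> R}" "independent B"
    "{x \<in> \<Lambda>. \<forall>k. \<bar>x $ k\<bar> \<le> R} \<subseteq> span B" "card B = dim {x \<in> \<Lambda>. \<forall>k. \<bar>x $ k\<bar> \<le> R}"
    by (rule basis_exists)
  have finB: "finite B" using B(2) independent_imp_finite by blast
  have "dim {x \<in> \<Lambda>. \<forall>k. \<bar>x $ k\<bar> \<le> R} = CARD('k)"
    using dim_span[of "{x \<in> \<Lambda>. \<forall>k. \<bar>x $ k\<bar> \<le> R}"] span by simp
  then have cB: "card B = CARD('k)" using B(4) by simp
  have "span B = UNIV" using B(3) span span_mono[OF B(3)] by (simp add: span_span UNIV_eq_I top.extremum_unique)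
  then have "(1 / real N) *\<^sub>R (z - w) \<in> span B" by simp
  then obtain u where u: "(1 / real N) *\<^sub>R (z - w) = (\<Sum>b\<in>B. u b *\<^sub>R b)"
    using span_finite[OF finB] by auto
  define x where "x = (\<Sum>b\<in>B. of_int \<lfloor>u b\<rfloor> *\<^sub>R b)"
  have "(\<Sum>b\<in>C. of_int \<lfloor>u b\<rfloor> *\<^sub>R b) \<in> \<Lambda>" if "C \<subseteq> B" for C
    using finite_subset[OF that finB] that
    by (induction C rule: finite_induct) (use B(1) in \<open>auto intro!: zero add scale\<close>)
  then have x: "x \<in> \<Lambda>" by (simp add: x_def)
  have e1: "z - w = real N *\<^sub>R (\<Sum>b\<in>B. u b *\<^sub>R b)"
    using assms(5) by (simp flip: u)
  have e2: "w + real N *\<^sub>R x - z = - (real N *\<^sub>R (\<Sum>b\<in>B. frac (u b) *\<^sub>R b))"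
  proof -
    have "w + real N *\<^sub>R x - z = real N *\<^sub>R x - (z - w)" by simp
    also have "\<dots> = - (real N *\<^sub>R ((\<Sum>b\<in>B. u b *\<^sub>R b) - x))" unfolding e1 by (simp add: scaleR_diff_right)
    also have "(\<Sum>b\<in>B. u b *\<^sub>R b) - x = (\<Sum>b\<in>B. frac (u b) *\<^sub>R b)"
      by (simp add: x_def frac_def scaleR_diff_left sum_subtractf)
    finally show ?thesis .
  qed
  show thesis
  proof (rule that[OF x])
    fix k
    have "\<bar>(w + real N *\<^sub>R x) $ k - z $ k\<bar> = \<bar>(w + real N *\<^sub>R x - z) $ k\<bar>" by simp
    also have "\<dots> = real N * \<bar>\<Sum>b\<in>B. frac (u b) * b $ k\<bar>"
      unfolding e2 by (simp add: abs_mult)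
    also have "\<dots> \<le> real N * (\<Sum>b\<in>B. 1 * R)"
    proof (intro mult_left_mono order_trans[OF sum_abs] sum_mono)
      fix b assume "b \<in> B"
      then have "\<bar>b $ k\<bar> \<le> R" using B(1) by auto
      then show "\<bar>frac (u b) * b $ k\<bar> \<le> 1 * R"
        unfolding abs_mult using frac_lt_1[of "u b"] by (intro mult_mono) (auto simp: frac_ge_0)
    qed auto
    finally show "\<bar>(w + real N *\<^sub>R x) $ k - z $ k\<bar> \<le> N * CARD('k) * R" by (simp add: cB mult_ac)
  qed
qed

section \<open>The lattice of rescaled integer points\<close>

definition emb :: "nat \<Rightarrow> real ^ 'n::finite ^ 'm::finite \<Rightarrow> int ^ 'm \<Rightarrow> int ^ 'n \<Rightarrow> real ^ ('m + 'n)" where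
  "emb T \<theta> p q = (\<chi> k. case k of
     Inl j \<Rightarrow> real T ^ CARD('n) * (\<theta> *v rvec q + rvec p) $ j
   | Inr r \<Rightarrow> of_int (q $ r) / real T ^ CARD('m))"

lemma emb_Inl [simp]: "emb T \<theta> p q $ Inl j = real T ^ CARD('n) * (\<theta> *v rvec q + rvec p) $ j"
  and emb_Inr [simp]: "emb T \<theta> p q $ Inr r = of_int (q $ r) / real T ^ CARD('m)"
  for \<theta> :: "real ^ 'n::finite ^ 'm::finite"
  by (simp_all add: emb_def)

lemma rvec_add: "rvec (x + y) = rvec x + rvec y"
  and rvec_diff: "rvec (x - y) = rvec x - rvec y"
  and rvec_smult: "rvec (t *s x) = of_int t *\<^sub>R rvec x"
  and rvec_0: "rvec 0 = 0"
  by (simp_all add: rvec_def vec_eq_iff)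

lemma all_sum_type: "(\<forall>k. P k) \<longleftrightarrow> (\<forall>j. P (Inl j)) \<and> (\<forall>r. P (Inr r))"
  by (metis sumE)

lemma emb_add: "emb T \<theta> p q + emb T \<theta> p' q' = emb T \<theta> (p + p') (q + q')"
  by (simp add: vec_eq_iff all_sum_type rvec_add matrix_vector_right_distrib algebra_simps add_divide_distrib)

lemma emb_smult: "of_int t *\<^sub>R emb T \<theta> p q = emb T \<theta> (t *s p) (t *s q)"
  by (simp add: vec_eq_iff all_sum_type rvec_smult matrix_vector_mult_scaleR algebra_simps)

lemma emb_diff: "emb T \<theta> p q - emb T \<theta> p' q' = emb T \<theta> (p - p') (q - q')"
  by (simp add: vec_eq_iff all_sum_type rvec_diff matrix_vector_mult_diff_distrib algebra_simps diff_divide_distrib)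

lemma emb_0: "emb T \<theta> 0 0 = 0"
  by (simp add: vec_eq_iff all_sum_type rvec_0)

text \<open>The box with sides \<open>T\<^sup>n\<close> in the first \<open>m\<close> coordinates
  and \<open>R\<close> in the last \<open>n\<close> contains at least as many lattice points as its
  volume: every \<open>q\<close> with entries in \<open>{0..<R * T\<^sup>m}\<close> has a
  \<open>p\<close> that reduces \<open>\<theta> q + p\<close> to fractional parts. The condition
  \<open>R \<le> T\<close> makes every side at least \<open>R\<close>.\<close>

lemma span_short_emb:
  fixes \<theta> :: "real ^ 'n::finite ^ 'm::finite"
  assumes gap: "has_gap T h \<theta>" and "h \<ge> 2" "T \<ge> 1"
    and R: "2 * (h * CARD('m + 'n)) ^ CARD('m + 'n) < R" "R \<le> T"
  shows "span {x \<in> {emb T \<theta> p q |p q. True}. \<forall>k. \<bar>x $ k\<bar> \<le> real R} = UNIV"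
proof -
  define f where "f q = emb T \<theta> (\<chi> j. - \<lfloor>(\<theta> *v rvec q) $ j\<rfloor>) q" for q
  define Y where "Y = f ` {q. \<forall>r. q $ r \<in> {0..<int (R * T ^ CARD('m))}}"
  define L where "L = (\<lambda>k :: 'm + 'n. case k of Inl _ \<Rightarrow> T ^ CARD('n) | Inr _ \<Rightarrow> R)"
  have inj: "inj f"
  proof (rule injI)
    fix q q' assume "f q = f q'"
    then have "f q $ Inr r = f q' $ Inr r" for r by simp
    then show "q = q'" using assms(3) by (simp add: f_def vec_eq_iff)
  qed
  show ?thesis
  proof (rule span_short_vectors[where h = h and L = L and Y = Y])
    fix x assume "x \<in> {emb T \<theta> p q |p q. True}" and x: "\<And>k. \<bar>x $ k\<bar> \<le> 1 / real h"
    then obtain p q where pq: "x = emb T \<theta> p q" by auto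
    have 1: "\<bar>(\<theta> *v rvec q + rvec p) $ j\<bar> \<le> 1 / (real h * real T ^ CARD('n))" for j
      using x[of "Inl j"] assms(2,3) by (simp add: pq abs_mult field_simps del: vector_add_component)
    moreover have "real h * \<bar>real_of_int (q $ r)\<bar> \<le> real T ^ CARD('m)" for r
      using x[of "Inr r"] assms(2,3) by (simp add: pq field_simps)
    ultimately have q: "q = 0" using gap by (auto simp: has_gap_def)
    have "p $ j = 0" for j
    proof -
      have "\<bar>real_of_int (p $ j)\<bar> \<le> 1 / (real h * real T ^ CARD('n))" using 1[of j] by (simp add: q rvec_0) (simp add: rvec_def)
      also have "\<dots> < 1"
      proof -
        have "1 \<le> real T ^ CARD('n)" using assms(3) by simp
        then have "2 * 1 \<le> real h * real T ^ CARD('n)" using assms(2) by (intro mult_mono) auto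
        then show ?thesis by (simp add: field_simps)
      qed
      finally show ?thesis by linarith
    qed
    then have "p = 0" by (simp add: vec_eq_iff)
    then show "x = 0" by (simp add: pq q emb_0)
  next
    fix k :: "'m + 'n"
    have "T ^ 1 \<le> T ^ CARD('n)" using assms(3) by (intro power_increasing) (auto simp: Suc_leI)
    then show "R \<le> L k" using R(2) by (auto simp: L_def split: sum.split)
  next
    show "finite Y" unfolding Y_def by (intro finite_imageI finite_vec_box) auto
    have "(\<Prod>k\<in>UNIV. L k) = (T ^ CARD('n)) ^ CARD('m) * R ^ CARD('n)"
      by (subst UNIV_Plus_UNIV[symmetric], subst prod.Plus) (simp_all add: L_def)
    also have "\<dots> = (R * T ^ CARD('m)) ^ CARD('n)"
      by (simp add: power_mult_distrib mult.commute flip: power_mult)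
    also have "\<dots> = card Y"
      unfolding Y_def by (subst card_image[OF inj_on_subset[OF inj]]) (simp_all add: card_vec_box nat_mult_distrib nat_power_eq del: atLeastLessThan_iff)
    finally show "(\<Prod>k\<in>UNIV. L k) \<le> card Y" by simp
    show "Y \<subseteq> {emb T \<theta> p q |p q. True}" by (auto simp: Y_def f_def)
  next
    fix y k assume "y \<in> Y"
    then obtain q where q: "y = f q" "\<And>r. 0 \<le> q $ r \<and> q $ r < int (R * T ^ CARD('m))" by (auto simp: Y_def)
    show "0 \<le> y $ k \<and> y $ k < real (L k)"
    proof (cases k)
      case (Inl j)
      have "y $ k = real T ^ CARD('n) * frac ((\<theta> *v rvec q) $ j)"
        by (simp add: q f_def Inl frac_def) (simp add: rvec_def)
      then show ?thesis using assms(3) frac_lt_1[of "(\<theta> *v rvec q) $ j"] frac_ge_0[of "(\<theta> *v rvec q) $ j"]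
        by (simp add: L_def Inl)
    next
      case (Inr r)
      have "real_of_int (q $ r) < real_of_int (int (R * T ^ CARD('m)))"
        using q(2)[of r] of_int_less_iff by blast
      then show ?thesis using q(2)[of r] assms(3) by (simp add: q(1) f_def Inr L_def field_simps)
    qed
  next
    show "x - y \<in> {emb T \<theta> p q |p q. True}" if "x \<in> {emb T \<theta> p q |p q. True}" "y \<in> {emb T \<theta> p q |p q. True}" for x y
      using that by clarify (subst emb_diff, blast)
  qed (use assms R in auto)
qed

text \<open>Rounding with error at most \<open>M\<close> towards the centre \<open>z\<close>, whose
  last coordinates are \<open>2 * M\<close>, puts the entries of \<open>q / T\<^sup>m\<close>
  between \<open>M\<close> and \<open>3 * M\<close>. The lower bound lets a small change of
  \<open>\<theta>\<close> cancel \<open>\<theta> q + p\<close>. \<open>M\<close> does not involve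
  \<open>T\<close>.\<close>

lemma congruent_lattice_point:
  fixes \<theta> :: "real ^ 'n::finite ^ 'm::finite" and vP :: "int ^ 'm" and vQ :: "int ^ 'n"
  assumes gap: "has_gap T h \<theta>" and "h \<ge> 2" "T \<ge> 1"
    and R: "2 * (h * CARD('m + 'n)) ^ CARD('m + 'n) < R" "R \<le> T" and "N \<ge> 1"
  defines "M \<equiv> N * CARD('m + 'n) * R"
  obtains p :: "int ^ 'm" and q :: "int ^ 'n" where
    "\<And>j. [p $ j = vP $ j] (mod int N)" "\<And>r. [q $ r = vQ $ r] (mod int N)"
    "\<And>j. \<bar>(\<theta> *v rvec q + rvec p) $ j\<bar> \<le> real M / real T ^ CARD('n)"
    "\<And>r. int M * int T ^ CARD('m) \<le> q $ r" "\<And>r. q $ r \<le> 3 * int M * int T ^ CARD('m)"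
proof -
  let ?\<Lambda> = "{emb T \<theta> p q |p q. True}"
  define z :: "real ^ ('m + 'n)" where "z = (\<chi> k. case k of Inl _ \<Rightarrow> 0 | Inr _ \<Rightarrow> 2 * real M)"
  obtain x where x: "x \<in> ?\<Lambda>" "\<And>k. \<bar>(emb T \<theta> vP vQ + real N *\<^sub>R x) $ k - z $ k\<bar> \<le> N * CARD('m + 'n) * real R"
  proof (rule round_to_lattice[where \<Lambda> = ?\<Lambda> and R = "real R" and N = N and w = "emb T \<theta> vP vQ" and z = z])
    show "span {x \<in> ?\<Lambda>. \<forall>k. \<bar>x $ k\<bar> \<le> real R} = UNIV"
      by (rule span_short_emb[OF assms(1-5)])
    show "0 \<in> ?\<Lambda>" using emb_0[of T \<theta>] by (metis (mono_tags, lifting) mem_Collect_eq)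
    show "x + y \<in> ?\<Lambda>" if "x \<in> ?\<Lambda>" "y \<in> ?\<Lambda>" for x y using that by clarify (subst emb_add, blast)
    show "of_int t *\<^sub>R x \<in> ?\<Lambda>" if "x \<in> ?\<Lambda>" for x t using that by clarify (subst emb_smult, blast)
  qed (use assms that in auto)
  then obtain p' q' where pq': "x = emb T \<theta> p' q'" by auto
  define p q where "p = vP + int N *s p'" and "q = vQ + int N *s q'"
  have e: "emb T \<theta> vP vQ + real N *\<^sub>R x = emb T \<theta> p q"
    using emb_smult[of "int N" T \<theta> p' q'] by (simp add: pq' emb_add p_def q_def)
  have b: "\<bar>emb T \<theta> p q $ k - z $ k\<bar> \<le> real M" for k
    using x(2)[of k] unfolding e by (simp add: M_def)
  have Tpos: "real T ^ k > 0" for k using assms(3) by simp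
  show thesis
  proof (rule that)
    show "[p $ j = vP $ j] (mod int N)" "[q $ r = vQ $ r] (mod int N)" for j r
      by (simp_all add: p_def q_def cong_def)
    show "\<bar>(\<theta> *v rvec q + rvec p) $ j\<bar> \<le> real M / real T ^ CARD('n)" for j
      using b[of "Inl j"] Tpos[of "CARD('n)"] by (simp add: z_def abs_mult field_simps del: vector_add_component)
    fix r
    have "real M \<le> q $ r / real T ^ CARD('m)" "q $ r / real T ^ CARD('m) \<le> 3 * real M"
      using b[of "Inr r"] by (auto simp: z_def abs_le_iff)
    then have "real_of_int (int M * int T ^ CARD('m)) \<le> real_of_int (q $ r)" "real_of_int (q $ r) \<le> real_of_int (3 * int M * int T ^ CARD('m))"
      using Tpos[of "CARD('m)"] by (auto simp: field_simps)
    then show "int M * int T ^ CARD('m) \<le> q $ r" "q $ r \<le> 3 * int M * int T ^ CARD('m)"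
      unfolding of_int_le_iff by auto
  qed
qed

section \<open>Solvability near a matrix with a gap\<close>

text \<open>Index 1 is subject to its approximation bound even when \<open>l = 0\<close>; the
  solutions below are accordingly constructed for all natural indices.\<close>

definition solvable ::
  "real \<Rightarrow> real \<Rightarrow> nat \<Rightarrow> (nat \<Rightarrow> nat ^ 'm) \<Rightarrow> (nat \<Rightarrow> nat ^ 'n) \<Rightarrow> (nat \<Rightarrow> int ^ 'm) \<Rightarrow> (nat \<Rightarrow> int ^ 'n) \<Rightarrow>
    real ^ 'n::finite ^ 'm::finite \<Rightarrow> nat \<Rightarrow> bool" where
  "solvable c \<delta> l NP NQ vP vQ \<theta> Q \<longleftrightarrow>
    (\<exists>p :: nat \<Rightarrow> int ^ 'm. \<exists>q :: nat \<Rightarrow> int ^ 'n.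
       (\<forall>i \<in> {1..l}. maxnorm (q i) \<le> int Q) \<and>
       maxnorm (\<theta> *v (rvec (q 1)) + rvec (p 1)) ^ CARD('m) \<le> c * real Q powr (- real CARD('n)) \<and>
       (\<forall>i \<in> {2..l}. maxnorm (\<theta> *v (rvec (q i)) + rvec (p i)) ^ CARD('m) \<le> c * real Q powr (- \<delta> * real CARD('n))) \<and>
       (\<forall>i \<in> {1..l}. (\<forall>j::'m. [p i $ j = vP i $ j] (mod int (NP i $ j))) \<and>
          (\<forall>r::'n. [q i $ r = vQ i $ r] (mod int (NQ i $ r)))))"

lemma maxnorm_le_iff: "maxnorm x \<le> b \<longleftrightarrow> (\<forall>j. \<bar>x $ j\<bar> \<le> b)"
  by (simp add: maxnorm_def)

lemma maxnorm_nonneg: "0 \<le> maxnorm x"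
  by (metis abs_ge_zero maxnorm_le_iff order_refl order_trans)

lemma matrix_vector_mult_bound:
  fixes A :: "real ^ 'n::finite ^ 'm::finite" and \<epsilon> b :: real
  assumes "\<And>i. \<bar>A $ j $ i\<bar> \<le> \<epsilon>" "\<And>i. \<bar>x $ i\<bar> \<le> b"
  shows "\<bar>(A *v x) $ j\<bar> \<le> CARD('n) * \<epsilon> * b"
proof -
  have "0 \<le> \<epsilon>" using order_trans[OF abs_ge_zero assms(1)] by simp
  then have "\<bar>A $ j $ i * x $ i\<bar> \<le> \<epsilon> * b" for i
    unfolding abs_mult using assms by (intro mult_mono) auto
  then have "\<bar>(A *v x) $ j\<bar> \<le> (\<Sum>i\<in>(UNIV :: 'n set). \<epsilon> * b)"
    unfolding matrix_vector_mult_def vec_lambda_beta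
    by (intro order_trans[OF sum_abs] sum_mono)
  then show ?thesis by simp
qed

lemma entry_le_norm:
  fixes A :: "real ^ 'n::finite ^ 'm::finite"
  shows "\<bar>A $ j $ i\<bar> \<le> norm A"
  using component_le_norm_cart[of "A $ j" i] Finite_Cartesian_Product.norm_nth_le[of A j] by linarith

text \<open>The centre \<open>y\<close> satisfies \<open>y q\<^sub>1 + p\<^sub>1 = 0\<close>, so
  near \<open>y\<close> only the displacement from \<open>y\<close> contributes at index 1, and
  \<open>c1\<close> takes \<open>\<kappa>\<close> small enough for that. At the other indices the
  error is a constant times \<open>1 / T\<^sup>n\<close>, which \<open>c2\<close> admits.\<close>

lemma solvable_near:
  fixes \<theta> :: "real ^ 'n::finite ^ 'm::finite" and p :: "nat \<Rightarrow> int ^ 'm" and q :: "nat \<Rightarrow> int ^ 'n"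
    and M T :: nat and \<kappa> \<tau> :: real
  defines "\<tau> \<equiv> 1 / real T ^ (CARD('n) + CARD('m))"
  assumes "T \<ge> 1" "M \<ge> 1" "0 < \<kappa>" "\<kappa> \<le> 1"
    and cong: "\<And>i j. i \<in> {1..l} \<Longrightarrow> [p i $ j = vP i $ j] (mod int (NP i $ j))"
      "\<And>i r. i \<in> {1..l} \<Longrightarrow> [q i $ r = vQ i $ r] (mod int (NQ i $ r))"
    and near: "\<And>i j. \<bar>(\<theta> *v rvec (q i) + rvec (p i)) $ j\<bar> \<le> real M / real T ^ CARD('n)"
    and q: "\<And>i r. int M * int T ^ CARD('m) \<le> q i $ r" "\<And>i r. q i $ r \<le> 3 * int M * int T ^ CARD('m)"
    and c1: "(3 * CARD('n) * M * \<kappa>) ^ CARD('m) * (3 * real M) ^ CARD('n) \<le> c"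
    and c2: "(7 * CARD('n) * M / real T ^ CARD('n)) ^ CARD('m) \<le> c * real (3 * M * T ^ CARD('m)) powr (- \<delta> * real CARD('n))"
  shows "\<exists>y. dist \<theta> y \<le> CARD('m) * \<tau> \<and>
    (\<forall>\<theta>'. dist y \<theta>' < \<kappa> * \<tau> \<longrightarrow> solvable c \<delta> l NP NQ vP vQ \<theta>' (3 * M * T ^ CARD('m)))"
proof -
  obtain s :: 'n where True by blast
  define w where "w = \<theta> *v rvec (q 1) + rvec (p 1)"
  define E :: "real ^ 'n ^ 'm" where "E = (\<chi> j i. if i = s then w $ j / of_int (q 1 $ s) else 0)"
  define y where "y = \<theta> - E"
  have \<tau>: "0 < \<tau>" using assms(2) by (simp add: \<tau>_def)
  have Tp: "0 < real T ^ k" for k using assms(2) by simp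
  have qpos: "real M * real T ^ CARD('m) \<le> real_of_int (q i $ r)"
    and qle: "real_of_int (q i $ r) \<le> 3 * real M * real T ^ CARD('m)" for i r
  proof -
    have "real_of_int (int M * int T ^ CARD('m)) \<le> real_of_int (q i $ r)"
      "real_of_int (q i $ r) \<le> real_of_int (3 * int M * int T ^ CARD('m))"
      using q of_int_le_iff by blast+
    then show "real M * real T ^ CARD('m) \<le> real_of_int (q i $ r)"
      "real_of_int (q i $ r) \<le> 3 * real M * real T ^ CARD('m)" by simp_all
  qed
  have MT: "0 < real M * real T ^ CARD('m)" using assms(2,3) by simp
  have qp: "0 < real_of_int (q i $ r)" for i r by (rule less_le_trans[OF MT qpos])
  have qb: "\<bar>rvec (q i) $ r\<bar> \<le> 3 * real M * real T ^ CARD('m)" for i r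
    using qp[of i r] qle[of i r] by (simp add: rvec_def)
  have E_le: "\<bar>E $ j $ i\<bar> \<le> \<tau>" for j i
  proof (cases "i = s")
    case True
    \<comment> \<open>Here the lower bound on \<open>q 1 $ s\<close> enters: it makes the correction
      \<open>E\<close> as small as \<open>\<tau>\<close>.\<close>
    have "\<bar>w $ j\<bar> / \<bar>of_int (q 1 $ s)\<bar> \<le> (real M / real T ^ CARD('n)) / (real M * real T ^ CARD('m))"
      using near[of 1 j] qpos[of 1 s] MT qp[of 1 s] unfolding w_def by (intro frac_le) auto
    also have "\<dots> = \<tau>" using assms(3) by (simp add: \<tau>_def power_add)
    finally show ?thesis using True by (simp add: E_def)
  next
    case False
    then show ?thesis using \<tau> by (simp add: E_def)
  qed
  \<comment> \<open>Each row of \<open>E\<close> has at most one nonzero entry, so passing to the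
    norm costs only the factor \<open>CARD('m)\<close>.\<close>
  have "norm E \<le> (\<Sum>j\<in>UNIV. norm (E $ j))" by (simp add: norm_vec_def L2_set_le_sum)
  also have "\<dots> \<le> (\<Sum>j\<in>(UNIV :: 'm set). \<tau>)"
  proof (rule sum_mono)
    fix j
    have "norm (E $ j) \<le> (\<Sum>i\<in>UNIV. \<bar>E $ j $ i\<bar>)" by (rule norm_le_l1_cart)
    also have "\<dots> = (\<Sum>i\<in>UNIV. if i = s then \<bar>w $ j / of_int (q 1 $ s)\<bar> else 0)"
      by (intro sum.cong) (auto simp: E_def)
    also have "\<dots> = \<bar>E $ j $ s\<bar>" by (simp add: E_def)
    also have "\<dots> \<le> \<tau>" by (rule E_le)
    finally show "norm (E $ j) \<le> \<tau>" .
  qed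
  finally have "dist \<theta> y \<le> CARD('m) * \<tau>" by (simp add: y_def dist_norm)
  moreover have "solvable c \<delta> l NP NQ vP vQ \<theta>' (3 * M * T ^ CARD('m))" if "dist y \<theta>' < \<kappa> * \<tau>" for \<theta>'
    unfolding solvable_def
  proof (intro exI[of _ p] exI[of _ q] conjI ballI allI)
    define F where "F = \<theta>' - y"
    have F_le: "\<bar>F $ j $ i\<bar> \<le> \<kappa> * \<tau>" for j i
      using entry_le_norm[of F j i] that by (simp add: F_def dist_norm norm_minus_commute)
    have EF: "\<theta>' = \<theta> + (F - E)" by (simp add: F_def y_def)
    have Fq: "\<bar>(F *v rvec (q i)) $ j\<bar> \<le> 3 * CARD('n) * M * \<kappa> / real T ^ CARD('n)" for i j
    proof -
      have "\<bar>(F *v rvec (q i)) $ j\<bar> \<le> CARD('n) * (\<kappa> * \<tau>) * (3 * real M * real T ^ CARD('m))"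
        by (rule matrix_vector_mult_bound[OF F_le qb])
      also have "\<dots> = 3 * CARD('n) * M * \<kappa> / real T ^ CARD('n)"
        using assms(2) by (simp add: \<tau>_def power_add field_simps)
      finally show ?thesis .
    qed
    have Eq: "\<bar>(E *v rvec (q i)) $ j\<bar> \<le> 3 * CARD('n) * M / real T ^ CARD('n)" for i j
    proof -
      have "\<bar>(E *v rvec (q i)) $ j\<bar> \<le> CARD('n) * \<tau> * (3 * real M * real T ^ CARD('m))"
        by (rule matrix_vector_mult_bound[OF E_le qb])
      also have "\<dots> = 3 * CARD('n) * M / real T ^ CARD('n)"
        using assms(2) by (simp add: \<tau>_def power_add field_simps)
      finally show ?thesis .
    qed
    have "(E *v rvec (q 1)) $ j = w $ j" for j
    proof -
      have "(E *v rvec (q 1)) $ j = (\<Sum>i\<in>UNIV. if i = s then w $ j else 0)"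
        unfolding matrix_vector_mult_def E_def rvec_def vec_lambda_beta
        using qp[of 1 s] by (intro sum.cong) auto
      then show ?thesis by simp
    qed
    then have Ew: "E *v rvec (q 1) = w" by (simp add: vec_eq_iff)
    have "\<theta>' *v rvec (q 1) + rvec (p 1) = F *v rvec (q 1)"
      unfolding EF matrix_vector_mult_add_rdistrib matrix_vector_mult_diff_rdistrib Ew by (simp add: w_def)
    then have "maxnorm (\<theta>' *v rvec (q 1) + rvec (p 1)) \<le> 3 * CARD('n) * M * \<kappa> / real T ^ CARD('n)"
      using Fq by (simp add: maxnorm_le_iff)
    then have "maxnorm (\<theta>' *v rvec (q 1) + rvec (p 1)) ^ CARD('m)
        \<le> (3 * CARD('n) * M * \<kappa> / real T ^ CARD('n)) ^ CARD('m)"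
      using maxnorm_nonneg by (rule power_mono)
    also have "\<dots> = (3 * CARD('n) * M * \<kappa>) ^ CARD('m) / (real T ^ CARD('m)) ^ CARD('n)"
      by (simp add: power_divide mult.commute flip: power_mult)
    also have "\<dots> \<le> (c / (3 * real M) ^ CARD('n)) / (real T ^ CARD('m)) ^ CARD('n)"
      using c1 assms(3) Tp by (intro divide_right_mono) (auto simp: pos_le_divide_eq)
    also have "\<dots> = c * real (3 * M * T ^ CARD('m)) powr (- real CARD('n))"
      using assms(2,3) by (simp add: powr_minus powr_realpow power_mult_distrib divide_inverse)
    finally show "maxnorm (\<theta>' *v rvec (q 1) + rvec (p 1)) ^ CARD('m)
        \<le> c * real (3 * M * T ^ CARD('m)) powr (- real CARD('n))" .
    show "maxnorm (q i) \<le> int (3 * M * T ^ CARD('m))" for i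
      unfolding maxnorm_le_iff
    proof
      fix r
      have "0 < q i $ r" using qp[of i r] by simp
      then show "\<bar>q i $ r\<bar> \<le> int (3 * M * T ^ CARD('m))" using q(2)[of i r] by simp
    qed
    show "maxnorm (\<theta>' *v rvec (q i) + rvec (p i)) ^ CARD('m)
        \<le> c * real (3 * M * T ^ CARD('m)) powr (- \<delta> * real CARD('n))" for i
    proof -
      \<comment> \<open>In units of \<open>1 / T\<^sup>n\<close>, \<open>\<theta>\<close>
        contributes \<open>M\<close>, and \<open>F\<close> and \<open>E\<close> contribute at most
        \<open>3 n M\<close> each, using \<open>\<kappa> \<le> 1\<close>; the total is at most
        \<open>7 n M\<close>.\<close>
      have "\<bar>(\<theta>' *v rvec (q i) + rvec (p i)) $ j\<bar> \<le> 7 * CARD('n) * M / real T ^ CARD('n)" for j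
      proof -
        have "(\<theta>' *v rvec (q i) + rvec (p i)) $ j
            = (\<theta> *v rvec (q i) + rvec (p i)) $ j + (F *v rvec (q i)) $ j - (E *v rvec (q i)) $ j"
          unfolding EF matrix_vector_mult_add_rdistrib matrix_vector_mult_diff_rdistrib by simp
        then have "\<bar>(\<theta>' *v rvec (q i) + rvec (p i)) $ j\<bar>
            \<le> real M / real T ^ CARD('n) + 3 * CARD('n) * M * \<kappa> / real T ^ CARD('n) + 3 * CARD('n) * M / real T ^ CARD('n)"
          using near[of i j] Fq[of i j] Eq[of i j] by linarith
        also have "\<dots> = (real M + 3 * CARD('n) * M * \<kappa> + 3 * CARD('n) * M) / real T ^ CARD('n)"
          by (simp add: add_divide_distrib)
        also have "\<dots> \<le> 7 * CARD('n) * M / real T ^ CARD('n)"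
        proof (rule divide_right_mono)
          have "real (3 * CARD('n) * M) * \<kappa> \<le> real (3 * CARD('n) * M) * 1"
            using assms(5) by (intro mult_left_mono) auto
          moreover have "1 * real M \<le> real CARD('n) * real M"
            by (intro mult_right_mono) (auto simp: Suc_leI)
          ultimately show "real M + 3 * CARD('n) * M * \<kappa> + 3 * CARD('n) * M \<le> 7 * CARD('n) * M"
            unfolding of_nat_mult of_nat_numeral mult_1 mult_1_right by linarith
        qed simp
        finally show ?thesis .
      qed
      then have "maxnorm (\<theta>' *v rvec (q i) + rvec (p i)) \<le> 7 * CARD('n) * M / real T ^ CARD('n)"
        by (simp only: maxnorm_le_iff) blast
      then have "maxnorm (\<theta>' *v rvec (q i) + rvec (p i)) ^ CARD('m) \<le> (7 * CARD('n) * M / real T ^ CARD('n)) ^ CARD('m)"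
        using maxnorm_nonneg by (rule power_mono)
      also note c2
      finally show ?thesis .
    qed
  qed (use cong in auto)
  ultimately show ?thesis by blast
qed

text \<open>The left side is a constant times \<open>T powr (- (a * b))\<close>, the right side a
  positive constant times \<open>T powr (- \<delta> * a * b)\<close>; \<open>\<delta> < 1\<close>
  makes the left side smaller in the end, whatever the constants.\<close>

lemma eventually_power_bound:
  fixes c \<delta> :: real
  assumes "0 < c" "\<delta> < 1" "0 < C" "a \<ge> 1" "b \<ge> 1"
  shows "\<forall>\<^sub>F T in sequentially. (K / real T ^ b) ^ a \<le> c * (C * real T ^ a) powr (- \<delta> * real b)"
proof -
  define e where "e = (1 - \<delta>) * real (a * b)"
  have e: "0 < e" using assms by (simp add: e_def)
  have "((\<lambda>T. K ^ a * real T powr (- e)) \<longlongrightarrow> K ^ a * 0) sequentially"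
    using e by (intro tendsto_mult tendsto_const tendsto_neg_powr filterlim_real_sequentially) auto
  then have "\<forall>\<^sub>F T in sequentially. K ^ a * real T powr (- e) < c * C powr (- \<delta> * real b)"
    using assms(1,3) by (intro order_tendstoD(2)) auto
  then show ?thesis
    using eventually_gt_at_top[of 0]
  proof eventually_elim
    case (elim T)
    have T: "0 < real T" using elim by simp
    have "(K / real T ^ b) ^ a = K ^ a / real T ^ (a * b)"
      by (simp add: power_divide mult.commute flip: power_mult)
    also have "\<dots> = K ^ a * real T powr (- real (a * b))"
      unfolding powr_minus powr_realpow[OF T] divide_inverse ..
    also have "- real (a * b) = - e + (- \<delta> * real (a * b))" by (simp add: e_def algebra_simps)
    also have "K ^ a * real T powr (- e + (- \<delta> * real (a * b)))
        = K ^ a * real T powr (- e) * real T powr (- \<delta> * real (a * b))"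
      by (simp only: powr_add mult.assoc)
    also have "\<dots> \<le> c * C powr (- \<delta> * real b) * real T powr (- \<delta> * real (a * b))"
      using elim by (intro mult_right_mono) auto
    also have "real T powr (- \<delta> * real (a * b)) = (real T ^ a) powr (- \<delta> * real b)"
      using T by (simp add: powr_powr mult_ac flip: powr_realpow)
    also have "c * C powr (- \<delta> * real b) * (real T ^ a) powr (- \<delta> * real b) = c * (C * real T ^ a) powr (- \<delta> * real b)"
      using assms(3) T by (simp add: powr_mult)
    finally show ?case .
  qed
qed

text \<open>At a point of the set, a large \<open>T\<close> with a gap yields a nearby ball of
  matrices solvable for some \<open>Q \<ge> k\<close>, and this ball avoids the set. Since
  \<open>M\<close> and \<open>\<kappa>\<close> do not depend on \<open>T\<close>, the relative size
  of the hole is constant and the set is porous.\<close>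

lemma negligible_gap_unsolvable:
  fixes NP :: "nat \<Rightarrow> nat ^ 'm::finite" and NQ :: "nat \<Rightarrow> nat ^ 'n::finite"
  assumes "c > 0" "\<delta> < 1"
    and NP: "\<And>i j. i \<in> {1..l} \<Longrightarrow> NP i $ j \<ge> 1" and NQ: "\<And>i r. i \<in> {1..l} \<Longrightarrow> NQ i $ r \<ge> 1"
    and h: "h \<ge> 2"
  shows "negligible {\<theta> :: real ^ 'n ^ 'm. (\<forall>T0. \<exists>T\<ge>T0. has_gap T h \<theta>) \<and>
    (\<forall>Q\<ge>k. \<not> solvable c \<delta> l NP NQ vP vQ \<theta> Q)}" (is "negligible ?E")
proof -
  \<comment> \<open>A common multiple of all moduli: congruences modulo \<open>N\<close> imply all
    those required.\<close>
  define N where "N = (\<Prod>i\<in>{1..l}. (\<Prod>j\<in>UNIV. NP i $ j) * (\<Prod>r\<in>UNIV. NQ i $ r))"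
  have "0 < NP i $ j" "0 < NQ i $ r" if "i \<in> {1..l}" for i j r
    using NP[OF that, of j] NQ[OF that, of r] by auto
  then have "0 < N" unfolding N_def by (intro prod_pos mult_pos_pos)
  then have N: "N \<ge> 1" by simp
  have NPd: "NP i $ j dvd N" and NQd: "NQ i $ r dvd N" if "i \<in> {1..l}" for i j r
  proof -
    have 1: "(\<Prod>j\<in>UNIV. NP i $ j) * (\<Prod>r\<in>UNIV. NQ i $ r) dvd N"
      unfolding N_def using that by (intro dvd_prodI) auto
    have "NP i $ j dvd (\<Prod>j\<in>UNIV. NP i $ j)" by (intro dvd_prodI) auto
    then show "NP i $ j dvd N" using 1 by (meson dvd_mult2 dvd_trans)
    have "NQ i $ r dvd (\<Prod>r\<in>UNIV. NQ i $ r)" by (intro dvd_prodI) auto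
    then show "NQ i $ r dvd N" using 1 by (meson dvd_mult dvd_trans)
  qed
  define R where "R = Suc (2 * (h * CARD('m + 'n)) ^ CARD('m + 'n))"
  define M where "M = N * CARD('m + 'n) * R"
  have M: "M \<ge> 1" using N by (simp add: M_def R_def Suc_leI)
  obtain \<kappa> :: real where \<kappa>: "0 < \<kappa>" "\<kappa> \<le> 1" "(3 * CARD('n) * M * \<kappa>) ^ CARD('m) * (3 * real M) ^ CARD('n) \<le> c"
  proof -
    define D where "D = (3 * CARD('n) * real M) ^ CARD('m) * (3 * real M) ^ CARD('n)"
    have D: "0 < D" using M by (simp add: D_def)
    \<comment> \<open>As \<open>\<kappa> \<le> 1\<close> gives
      \<open>\<kappa> ^ CARD('m) \<le> \<kappa>\<close>, it is enough that
      \<open>\<kappa> \<le> c / D\<close>.\<close>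
    define \<kappa> where "\<kappa> = min 1 (c / D)"
    have k: "0 < \<kappa>" "\<kappa> \<le> 1" "\<kappa> * D \<le> c" using D assms(1) by (auto simp: \<kappa>_def min_def field_simps)
    have "\<kappa> ^ CARD('m) \<le> \<kappa> ^ 1" using k by (intro power_decreasing) (auto simp: Suc_leI)
    then have "\<kappa> ^ CARD('m) * D \<le> \<kappa> * D" using D by (intro mult_right_mono) auto
    then have "(3 * CARD('n) * M * \<kappa>) ^ CARD('m) * (3 * real M) ^ CARD('n) \<le> c"
      using k(3) by (simp add: D_def power_mult_distrib mult_ac)
    then show thesis by (rule that[OF k(1,2)])
  qed
  define \<tau> where "\<tau> T = 1 / real T ^ (CARD('n) + CARD('m))" for T
  show ?thesis
  proof (rule negligible_porous[where \<kappa> = "\<kappa> / (CARD('m) + 1)"])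
    have "\<kappa> < real CARD('m) + 1"
      using \<kappa>(2) zero_less_card_finite[where 'a = 'm] by linarith
    then show "0 < \<kappa> / (CARD('m) + 1)" "\<kappa> / (CARD('m) + 1) < 1"
      using \<kappa>(1) by (auto simp: add.commute)
    fix \<theta> e assume \<theta>: "\<theta> \<in> ?E" and e: "0 < (e::real)"
    have "(\<lambda>T. inverse (real T) ^ (CARD('n) + CARD('m))) \<longlonglongrightarrow> 0"
      by (intro tendsto_null_power lim_inverse_n) simp
    moreover have "\<tau> = (\<lambda>T. inverse (real T) ^ (CARD('n) + CARD('m)))"
      by (rule ext) (simp only: \<tau>_def divide_inverse power_inverse mult_1)
    ultimately have "\<tau> \<longlonglongrightarrow> 0" by simp
    then have "(\<lambda>T. (CARD('m) + 1) * \<tau> T) \<longlonglongrightarrow> 0" by (rule tendsto_mult_right_zero)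
    then have "\<forall>\<^sub>F T in sequentially. (CARD('m) + 1) * \<tau> T < e"
      using e by (intro order_tendstoD(2)) auto
    moreover have "\<forall>\<^sub>F T in sequentially. (7 * CARD('n) * M / real T ^ CARD('n)) ^ CARD('m)
        \<le> c * (3 * real M * real T ^ CARD('m)) powr (- \<delta> * real CARD('n))"
      using assms(1,2) M by (intro eventually_power_bound) (auto simp: Suc_leI)
    \<comment> \<open>\<open>R \<le> T\<close> is required for the short vectors to span;
      \<open>k \<le> T\<close> will give \<open>k \<le> Q\<close>.\<close>
    moreover have "\<forall>\<^sub>F T in sequentially. max R k \<le> T" by (rule eventually_ge_at_top)
    ultimately have "\<forall>\<^sub>F T in sequentially. (CARD('m) + 1) * \<tau> T < e \<and>
       (7 * CARD('n) * M / real T ^ CARD('n)) ^ CARD('m)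
        \<le> c * (3 * real M * real T ^ CARD('m)) powr (- \<delta> * real CARD('n)) \<and> max R k \<le> T"
      by eventually_elim simp
    then obtain T0 where T0: "(CARD('m) + 1) * \<tau> T < e \<and>
       (7 * CARD('n) * M / real T ^ CARD('n)) ^ CARD('m)
        \<le> c * (3 * real M * real T ^ CARD('m)) powr (- \<delta> * real CARD('n)) \<and> max R k \<le> T" if "T \<ge> T0" for T
      unfolding eventually_sequentially by blast
    obtain T where "T \<ge> T0" "has_gap T h \<theta>" using \<theta> by blast
    with T0[of T] have T: "has_gap T h \<theta>" "(CARD('m) + 1) * \<tau> T < e"
       "(7 * CARD('n) * M / real T ^ CARD('n)) ^ CARD('m)
        \<le> c * (3 * real M * real T ^ CARD('m)) powr (- \<delta> * real CARD('n))" "R \<le> T" "k \<le> T"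
      by simp_all
    have T1: "T \<ge> 1" using T(4) by (simp add: R_def)
    have \<tau>: "0 < \<tau> T" using T1 by (simp add: \<tau>_def)
    have Rlt: "2 * (h * CARD('m + 'n)) ^ CARD('m + 'n) < R" by (simp add: R_def)
    have "\<exists>p q. (\<forall>j. [p $ j = vP i $ j] (mod int N)) \<and> (\<forall>r. [q $ r = vQ i $ r] (mod int N)) \<and>
        (\<forall>j. \<bar>(\<theta> *v rvec q + rvec p) $ j\<bar> \<le> real M / real T ^ CARD('n)) \<and>
        (\<forall>r. int M * int T ^ CARD('m) \<le> q $ r \<and> q $ r \<le> 3 * int M * int T ^ CARD('m))" for i
      by (rule congruent_lattice_point[OF T(1) h T1 Rlt T(4) N, of "vP i" "vQ i", folded M_def], intro exI conjI allI)
    then obtain p q where pq: "\<And>i j. [p i $ j = vP i $ j] (mod int N)" "\<And>i r. [q i $ r = vQ i $ r] (mod int N)"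
        "\<And>i j. \<bar>(\<theta> *v rvec (q i) + rvec (p i)) $ j\<bar> \<le> real M / real T ^ CARD('n)"
        "\<And>i r. int M * int T ^ CARD('m) \<le> q i $ r" "\<And>i r. q i $ r \<le> 3 * int M * int T ^ CARD('m)"
      by metis
    define Q where "Q = 3 * M * T ^ CARD('m)"
    have "\<exists>y. dist \<theta> y \<le> CARD('m) * \<tau> T \<and>
      (\<forall>\<theta>'. dist y \<theta>' < \<kappa> * \<tau> T \<longrightarrow> solvable c \<delta> l NP NQ vP vQ \<theta>' Q)"
      unfolding \<tau>_def Q_def
    proof (rule solvable_near[OF T1 M \<kappa>(1,2) _ _ pq(3-5) \<kappa>(3)])
      show "[p i $ j = vP i $ j] (mod int (NP i $ j))" if "i \<in> {1..l}" for i j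
        by (rule cong_dvd_modulus[OF pq(1)]) (use NPd[OF that] in simp)
      show "[q i $ r = vQ i $ r] (mod int (NQ i $ r))" if "i \<in> {1..l}" for i r
        by (rule cong_dvd_modulus[OF pq(2)]) (use NQd[OF that] in simp)
    qed (use T(3) in simp)
    then obtain y where y: "dist \<theta> y \<le> CARD('m) * \<tau> T"
      "\<And>\<theta>'. dist y \<theta>' < \<kappa> * \<tau> T \<Longrightarrow> solvable c \<delta> l NP NQ vP vQ \<theta>' Q" by blast
    have "T ^ 1 \<le> T ^ CARD('m)" using T1 by (intro power_increasing) (auto simp: Suc_leI)
    also have "\<dots> \<le> Q" using M by (simp add: Q_def)
    finally have Q: "k \<le> Q" using T(5) by simp
    \<comment> \<open>\<open>y\<close> is within \<open>CARD('m) * \<tau> T\<close> of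
      \<open>\<theta>\<close> and the hole has radius at most \<open>\<tau> T\<close>, so this
      radius encloses the hole.\<close>
    define \<rho> where "\<rho> = (CARD('m) + 1) * \<tau> T"
    have \<rho>: "\<kappa> / (CARD('m) + 1) * \<rho> = \<kappa> * \<tau> T" by (simp add: \<rho>_def)
    show "\<exists>\<rho> y. 0 < \<rho> \<and> \<rho> < e \<and> ball y (\<kappa> / (CARD('m) + 1) * \<rho>) \<subseteq> cball \<theta> \<rho> \<and>
        ball y (\<kappa> / (CARD('m) + 1) * \<rho>) \<inter> ?E = {}"
    proof (intro exI[of _ \<rho>] exI[of _ y] conjI)
      show "0 < \<rho>" "\<rho> < e" using \<tau> T(2) by (auto simp: \<rho>_def)
      show "ball y (\<kappa> / (CARD('m) + 1) * \<rho>) \<subseteq> cball \<theta> \<rho>"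
      proof
        fix x assume "x \<in> ball y (\<kappa> / (CARD('m) + 1) * \<rho>)"
        then have "dist y x < \<kappa> * \<tau> T" unfolding \<rho> by simp
        also have "\<dots> \<le> 1 * \<tau> T" using \<kappa> \<tau> by (intro mult_right_mono) auto
        finally have "dist \<theta> x \<le> CARD('m) * \<tau> T + \<tau> T" using y(1) dist_triangle[of \<theta> x y] by linarith
        then show "x \<in> cball \<theta> \<rho>" by (simp add: \<rho>_def algebra_simps)
      qed
      show "ball y (\<kappa> / (CARD('m) + 1) * \<rho>) \<inter> ?E = {}"
        unfolding \<rho> using y(2) Q by auto
    qed
  qed
qed

text \<open>The exceptional matrices lie in a countable union of negligible sets: those whose gaps
  eventually stop for every \<open>h \<ge> 6\<close>, and, for each \<open>h\<close> and
  \<open>k\<close>, those with gaps at arbitrarily large \<open>T\<close> but no solution with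
  \<open>Q \<ge> k\<close>.\<close>

theorem theorem1p3:
  fixes c \<delta> :: real and l :: nat
    and NP :: "nat \<Rightarrow> nat ^ 'm::finite" and NQ :: "nat \<Rightarrow> nat ^ 'n::finite"
    and vP :: "nat \<Rightarrow> int ^ 'm" and vQ :: "nat \<Rightarrow> int ^ 'n"
  assumes "c > 0" and "\<delta> < 1"
    and "\<And>i j1. i \<in> {1..l} \<Longrightarrow> NP i $ j1 \<ge> 1"
    and "\<And>i r1. i \<in> {1..l} \<Longrightarrow> NQ i $ r1 \<ge> 1"
  shows "AE \<theta> in (lborel :: (real ^ 'n ^ 'm) measure).
    infinite {Q :: nat. Q > 0 \<and>
      (\<exists>p :: nat \<Rightarrow> int ^ 'm. \<exists>q :: nat \<Rightarrow> int ^ 'n.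
         (\<forall>i \<in> {1..l}. maxnorm (q i) \<le> int Q) \<and>
         maxnorm (\<theta> *v (rvec (q 1)) + rvec (p 1)) ^ CARD('m)
            \<le> c * real Q powr (- real CARD('n)) \<and>
         (\<forall>i \<in> {2..l}.
            maxnorm (\<theta> *v (rvec (q i)) + rvec (p i)) ^ CARD('m)
              \<le> c * real Q powr (- \<delta> * real CARD('n))) \<and>
         (\<forall>i \<in> {1..l}.
            (\<forall>j::'m. [p i $ j = vP i $ j] (mod int (NP i $ j))) \<and>
            (\<forall>r::'n. [q i $ r = vQ i $ r] (mod int (NQ i $ r)))))}"
proof -
  \<comment> \<open>The shift by 2 lets \<open>h\<close> range over all naturals while respecting
    the bound \<open>h \<ge> 2\<close> of \<open>negligible_gap_unsolvable\<close>.\<close>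
  define E where "E h k = {\<theta> :: real ^ 'n ^ 'm. (\<forall>T0. \<exists>T\<ge>T0. has_gap T (h + 2) \<theta>) \<and>
    (\<forall>Q\<ge>k. \<not> solvable c \<delta> l NP NQ vP vQ \<theta> Q)}" for h k
  define G where "G = {\<theta> :: real ^ 'n ^ 'm. \<forall>h\<ge>6. \<exists>T0. \<forall>T\<ge>T0. \<not> has_gap T h \<theta>}"
  have "negligible (E h k)" for h k
    unfolding E_def using assms by (intro negligible_gap_unsolvable) auto
  then have "negligible (G \<union> (\<Union>h. \<Union>k. E h k))"
    unfolding G_def by (intro negligible_Un negligible_Union_nat negligible_eventually_no_gap)
  then have "AE \<theta> in lebesgue. \<theta> \<notin> G \<union> (\<Union>h. \<Union>k. E h k)"
    unfolding negligible_iff_null_sets by (rule AE_not_in)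
  then have "AE \<theta> in lborel. \<theta> \<notin> G \<union> (\<Union>h. \<Union>k. E h k)"
    by (simp only: AE_completion_iff)
  then have "AE \<theta> in (lborel :: (real ^ 'n ^ 'm) measure). infinite {Q. Q > 0 \<and> solvable c \<delta> l NP NQ vP vQ \<theta> Q}"
  proof eventually_elim
    case (elim \<theta>)
    then have nG: "\<theta> \<notin> G" and nE: "\<And>h k. \<theta> \<notin> E h k" by auto
    obtain h where h: "h \<ge> 6" "\<forall>T0. \<exists>T\<ge>T0. has_gap T h \<theta>" using nG by (auto simp: G_def)
    have "h - 2 + 2 = h" using h(1) by simp
    \<comment> \<open>Asking for \<open>Q \<ge> Suc k\<close> ensures \<open>Q > 0\<close>.\<close>
    then have Suc_k: "\<exists>Q\<ge>Suc k. solvable c \<delta> l NP NQ vP vQ \<theta> Q" for k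
      using nE[of "h - 2" "Suc k"] h(2) by (auto simp: E_def)
    have "\<exists>Q\<ge>k. Q \<in> {Q. Q > 0 \<and> solvable c \<delta> l NP NQ vP vQ \<theta> Q}" for k
    proof -
      obtain Q where "Q \<ge> Suc k" "solvable c \<delta> l NP NQ vP vQ \<theta> Q"
        using Suc_k by blast
      then show ?thesis by (intro exI[of _ Q]) auto
    qed
    then show ?case unfolding infinite_nat_iff_unbounded_le by blast
  qed
  then show ?thesis unfolding solvable_def .
qed

end
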